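(* Suppose $p(t)>0$ for $t\in\mathcal{I}$ and there exist $N\in\mathcal{I}$, a sequence of positive numbers $\{M(t)\}_{t=N}^{\infty}$, and positive constants $k_j$, $1\le j\le4$, such that for all $t>N$: 1) $|c(t)|+|c(t-1)|\le k_1M(t)$ and $|h(t)|\le k_2M(t)$; 2) $q(t)\ge-k_3M(t)$; 3) $\dfrac{p^{1/2}(t-1)\,|\nabla M(t)|}{M^{1/2}(t)\,M(t-1)}\le k_4$; and 4) $\displaystyle\sum_{t=N}^{\infty}\frac{1}{\left(p^2(t-1)+c^2(t-1)\right)^{1/4}M^{1/2}(t)}=\infty$. Then $\mathcal{L}$ is in the limit point case (LPC) at $t=\infty$.
   Context: Let $a\in\mathbb{Z}$, $\mathcal{I}=\{a,a+1,\dots\}$, $\mathcal{I}'=\{a-1,a,a+1,\dots\}$. $\nabla y(t)=y(t)-y(t-1)$, $\Delta y(t)=y(t+1)-y(t)$. Let $p,q,c,h,d:\mathcal{I}'\to\mathbb{R}$ with $p(t)\ne0$ for all $t$. For $\lambda\in\mathbb{C}$, $(E_\lambda)$ (abbreviated $\mathcal{L}(y)=\lambda y$) is the system for $y=(y_1,y_2)^{\mathrm T}:\mathcal{I}'\to\mathbb{C}^2$: $$-\nabla(p(t)\Delta y_1(t))+q(t)y_1(t)-\nabla(c(t)y_2(t))+h(t)y_2(t)=\lambda y_1(t),\quad t\in\mathcal{I},$$ $$c(t)\Delta y_1(t)+h(t)y_1(t)+d(t)y_2(t)=\lambda y_2(t),\quad t\in\mathcal{I}'.$$ $y^{[1]}(t)=p(t)\Delta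 y_1(t)+c(t)y_2(t)$, $t\in\mathcal{I}'$. Weyl circles and LPC. For $\lambda\in\mathbb{C}\setminus\mathbb{R}$ and $\alpha\in[0,\pi)$ let $\varphi,\psi$ be the (unique) solutions of $(E_\lambda)$ with $\varphi_1(a)=\sin\alpha$, $\varphi^{[1]}(a-1)=-\cos\alpha$, $\psi_1(a)=\cos\alpha$, $\psi^{[1]}(a-1)=\sin\alpha$. For an integer $N>a$ and $\beta\in[0,\pi)$ put $U_2(y)=y_1(N+1)\cos\beta+y^{[1]}(N)\sin\beta$. As $\beta$ ranges over $[0,\pi)$, the points $m=-U_2(\varphi)/U_2(\psi)$ describe a circle $C_N$ in $\mathbb{C}$; the closed discs bounded by $C_N$ decrease as $N$ increases. The sequence $\{C_N\}$ is said to converge to a point if the intersection of these closed discs is a single point (otherwise it is a closed disc of positive radius). $\mathcal{L}$ is in the LPC at $t=\infty$ if $\{C_N\}$ converges to a point, for every $\lambda\in\mathbb{C}\setminus\mathbb{R}$ and every $\alpha\in[0,\pi)$. *)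

theory Defs
  imports "HOL-Analysis.Analysis"
begin

definition fwd_diff :: "(int \<Rightarrow> 'a::ab_group_add) \<Rightarrow> int \<Rightarrow> 'a"
  where "fwd_diff f t = f (t + 1) - f t"

definition bwd_diff :: "(int \<Rightarrow> 'a::ab_group_add) \<Rightarrow> int \<Rightarrow> 'a"
  where "bwd_diff f t = f t - f (t - 1)"

text \<open>
  Functions on the discrete half-line \<open>{a - 1, a, a + 1, \<dots>}\<close> are represented by total functions
  on the integers; all definitions below only refer to their values at arguments \<open>\<ge> a - 1\<close>.
\<close>

definition solves_system ::
    "int \<Rightarrow> (int \<Rightarrow> real) \<Rightarrow> (int \<Rightarrow> real) \<Rightarrow> (int \<Rightarrow> real) \<Rightarrow> (int \<Rightarrow> real) \<Rightarrow> (int \<Rightarrow> real) \<Rightarrow>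
     complex \<Rightarrow> (int \<Rightarrow> complex ^ 2) \<Rightarrow> bool"
  where
  "solves_system a p q c h d lam y \<longleftrightarrow>
     (\<forall>t\<ge>a. - bwd_diff (\<lambda>s. of_real (p s) * fwd_diff (\<lambda>r. y r $ 1) s) t
              + of_real (q t) * y t $ 1
              - bwd_diff (\<lambda>s. of_real (c s) * y s $ 2) t
              + of_real (h t) * y t $ 2
            = lam * y t $ 1) \<and>
     (\<forall>t\<ge>a - 1. of_real (c t) * fwd_diff (\<lambda>r. y r $ 1) t
              + of_real (h t) * y t $ 1
              + of_real (d t) * y t $ 2
            = lam * y t $ 2)"

definition quasi_diff ::
    "(int \<Rightarrow> real) \<Rightarrow> (int \<Rightarrow> real) \<Rightarrow> (int \<Rightarrow> complex ^ 2) \<Rightarrow> int \<Rightarrow> complex"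
  where
  "quasi_diff p c y t =
     of_real (p t) * fwd_diff (\<lambda>r. y r $ 1) t + of_real (c t) * y t $ 2"

definition solves_ivp ::
    "int \<Rightarrow> (int \<Rightarrow> real) \<Rightarrow> (int \<Rightarrow> real) \<Rightarrow> (int \<Rightarrow> real) \<Rightarrow> (int \<Rightarrow> real) \<Rightarrow> (int \<Rightarrow> real) \<Rightarrow>
     complex \<Rightarrow> complex \<Rightarrow> complex \<Rightarrow> (int \<Rightarrow> complex ^ 2) \<Rightarrow> bool"
  where
  "solves_ivp a p q c h d lam A B y \<longleftrightarrow>
     solves_system a p q c h d lam y \<and> y a $ 1 = A \<and> quasi_diff p c y (a - 1) = B"

text \<open>
  For nonreal \<open>lam\<close> and nonvanishing \<open>p\<close> the initial value problem is uniquely solvable. Hence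
  quantifying universally over its solutions, as done in the definition of the limit point case
  below, amounts to speaking about the solution.
\<close>

lemma nonreal_shift_ne_0:
  assumes "lam \<notin> \<real>"
  shows "lam - complex_of_real x \<noteq> 0"
  using assms by auto

lemma principal_coeff_ne_0:
  assumes "lam \<notin> \<real>" "(p::real) \<noteq> 0"
  shows "complex_of_real p
           + of_real c * (of_real c - of_real h) / (lam - of_real d) \<noteq> 0"
proof
  let ?k = "c * (c - h)"
  assume *: "complex_of_real p
           + of_real c * (of_real c - of_real h) / (lam - of_real d) = 0"
  have "of_real p * (lam - of_real d) + of_real ?k = 0"
    using * nonreal_shift_ne_0[OF assms(1), of d] by (simp add: field_simps)
  hence "lam = of_real (d - ?k / p)"
    using assms(2) by (simp add: field_simps)
  thus False using assms(1) by simp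
qed

lemma solves_system_iff:
  "solves_system a p q c h d lam y \<longleftrightarrow>
     (\<forall>t\<ge>a. quasi_diff p c y t - of_real (h t) * y t $ 2
             = quasi_diff p c y (t - 1) + (of_real (q t) - lam) * y t $ 1) \<and>
     (\<forall>t\<ge>a - 1. (lam - of_real (d t)) * y t $ 2
             = of_real (c t) * (y (t + 1) $ 1 - y t $ 1) + of_real (h t) * y t $ 1)"
proof -
  have eq_iff: "x = y \<longleftrightarrow> u = v" if "x - y = v - u" for x y u v :: complex
    using that by (metis eq_iff_diff_eq_0)
  show ?thesis
    unfolding solves_system_def quasi_diff_def bwd_diff_def fwd_diff_def
    by (intro arg_cong2[where f = "(\<and>)"] all_cong1 imp_cong refl eq_iff)
       (simp_all add: algebra_simps)
qed

theorem solves_ivp_unique: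
  assumes p: "\<forall>t\<ge>a - 1. p t \<noteq> 0" and lam: "lam \<notin> \<real>"
    and y: "solves_ivp a p q c h d lam A B y" and z: "solves_ivp a p q c h d lam A B z"
    and t: "t \<ge> a - 1"
  shows "y t = z t"
proof -
  define w where "w t = y t - z t" for t
  have w: "solves_ivp a p q c h d lam 0 0 w"
  proof -
    have qw: "quasi_diff p c w t = quasi_diff p c y t - quasi_diff p c z t" for t
      unfolding quasi_diff_def fwd_diff_def w_def vector_minus_component
      by (simp add: algebra_simps)
    have sub: "(x - x') - k * (y - y') = (u - u') + l * (v - v')"
      if "x - k * y = u + l * v" "x' - k * y' = u' + l * v'"
      for x x' y y' u u' v v' k l :: complex
      using that by algebra
    have sub': "k * (x - x') = l * ((u - u') - (v - v')) + m * (v - v')"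
      if "k * x = l * (u - v) + m * v" "k * x' = l * (u' - v') + m * v'"
      for x x' u u' v v' k l m :: complex
      using that by algebra
    show ?thesis
      using y z unfolding solves_ivp_def solves_system_iff qw
      unfolding w_def vector_minus_component
      by (auto intro!: sub sub')
  qed
  note sys = w[unfolded solves_ivp_def solves_system_iff]
  have e: "lam - of_real (d t) \<noteq> 0" for t
    using nonreal_shift_ne_0[OF lam] .
  have w2: "w t $ 2 = (of_real (c t) * (w (t + 1) $ 1 - w t $ 1) + of_real (h t) * w t $ 1)
              / (lam - of_real (d t))" if "t \<ge> a - 1" for t
    using sys that e[of t] by (simp add: field_simps)
  note D = principal_coeff_ne_0[OF lam]
  have pD: "complex_of_real (p t) + of_real (c t) * (of_real (c t) - of_real (h t))
              / (lam - of_real (d t)) \<noteq> 0" if "t \<ge> a - 1" for t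
    using D p that by blast
  have start: "w (a - 1) $ 1 = 0"
  proof -
    have "- (complex_of_real (p (a - 1)) + of_real (c (a - 1)) * (of_real (c (a - 1))
            - of_real (h (a - 1))) / (lam - of_real (d (a - 1)))) * w (a - 1) $ 1 = 0"
    proof -
      have wa: "w a $ 1 = 0" and "quasi_diff p c w (a - 1) = 0"
        using sys by auto
      thus ?thesis
        using w2[of "a - 1"]
        by (simp add: quasi_diff_def fwd_diff_def algebra_simps add_divide_distrib
            diff_divide_distrib)
    qed
    moreover have "- x * y = 0 \<Longrightarrow> x \<noteq> 0 \<Longrightarrow> y = 0" for x y :: complex
      by simp
    ultimately show ?thesis using pD[of "a - 1"] by blast
  qed
  have main: "w t $ 1 = 0 \<and> quasi_diff p c w (t - 1) = 0" if "t \<ge> a" for t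
    using that
  proof (induction t rule: int_ge_induct)
    case base
    then show ?case using sys by simp
  next
    case (step t)
    have q: "quasi_diff p c w t - of_real (h t) * w t $ 2 = 0"
      using sys step by simp
    have w2t: "w t $ 2 = of_real (c t) * w (t + 1) $ 1 / (lam - of_real (d t))"
      using w2[of t] step by simp
    have "(complex_of_real (p t) + of_real (c t) * (of_real (c t) - of_real (h t))
              / (lam - of_real (d t))) * w (t + 1) $ 1 = 0"
      using q step unfolding quasi_diff_def fwd_diff_def w2t
      by (simp add: algebra_simps add_divide_distrib diff_divide_distrib)
    hence "w (t + 1) $ 1 = 0" using pD[of t] step by simp
    moreover have "quasi_diff p c w t = 0"
      using q w2t calculation by simp
    ultimately show ?case by simp
  qed
  have w1: "w t $ 1 = 0" if "t \<ge> a - 1" for t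
    using start main[of t] that by (cases "t = a - 1") auto
  have "w t $ 2 = 0"
    using w2[OF t] w1[OF t] w1[of "t + 1"] t by simp
  thus ?thesis using w1[OF t] unfolding w_def by (simp add: vec_eq_iff forall_2)
qed

theorem solves_ivp_exists:
  assumes p: "\<forall>t\<ge>a - 1. p t \<noteq> 0" and lam: "lam \<notin> \<real>"
  shows "\<exists>y. solves_ivp a p q c h d lam A B y"
proof -
  define e where "e t = lam - complex_of_real (d t)" for t
  have e: "e t \<noteq> 0" for t
    unfolding e_def using nonreal_shift_ne_0[OF lam] .
  define D where "D t = complex_of_real (p t)
      + of_real (c t) * (of_real (c t) - of_real (h t)) / e t" for t
  have D: "D t \<noteq> 0" if "t \<ge> a - 1" for t
    unfolding D_def e_def using principal_coeff_ne_0[OF lam] p that by blast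
  define dl where "dl t u v = (v + (of_real (q t) - lam) * u
      - (of_real (c t) - of_real (h t)) * of_real (h t) * u / e t) / D t" for t and u v :: complex
  define g where "g t u \<delta> = (of_real (c t) * \<delta> + of_real (h t) * u) / e t"
    for t and u \<delta> :: complex
  define S where "S = rec_nat (A, B) (\<lambda>n (u, v). let t = a + int n; \<delta> = dl t u v in
      (u + \<delta>, of_real (p t) * \<delta> + of_real (c t) * g t u \<delta>))"
  define \<delta>0 where "\<delta>0 = (B - of_real (c (a - 1)) * of_real (h (a - 1)) * A / e (a - 1)) / D (a - 1)"
  define Y where "Y t = (if t < a then A - \<delta>0 else fst (S (nat (t - a))))" for t
  define V where "V t = snd (S (nat (t + 1 - a)))" for t
  define y :: "int \<Rightarrow> complex ^ 2"
    where "y t = vector [Y t, g t (Y t) (Y (t + 1) - Y t)]" for t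
  have y1: "y t $ 1 = Y t" and y2: "y t $ 2 = g t (Y t) (Y (t + 1) - Y t)" for t
    by (simp_all add: y_def)
  have S0: "S 0 = (A, B)" by (simp add: S_def)
  have step: "Y (t + 1) - Y t = dl t (Y t) (V (t - 1))"
    "V t = of_real (p t) * (Y (t + 1) - Y t) + of_real (c t) * g t (Y t) (Y (t + 1) - Y t)"
    if "t \<ge> a" for t
  proof -
    have n: "nat (t + 1 - a) = Suc (nat (t - a))" "nat (t - 1 + 1 - a) = nat (t - a)"
      "a + int (nat (t - a)) = t"
      using that by auto
    have S_Suc: "S (nat (t + 1 - a)) = (Y t + dl t (Y t) (V (t - 1)),
        of_real (p t) * dl t (Y t) (V (t - 1))
          + of_real (c t) * g t (Y t) (dl t (Y t) (V (t - 1))))"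
      unfolding V_def Y_def n using that by (simp add: S_def case_prod_unfold Let_def)
    thus *: "Y (t + 1) - Y t = dl t (Y t) (V (t - 1))"
      using that by (simp add: Y_def)
    show "V t = of_real (p t) * (Y (t + 1) - Y t) + of_real (c t) * g t (Y t) (Y (t + 1) - Y t)"
      unfolding * using S_Suc by (simp add: V_def)
  qed
  have qd: "quasi_diff p c y t = V t" if "t \<ge> a" for t
    unfolding quasi_diff_def fwd_diff_def y1 y2 using step(2)[OF that] by simp
  have Ya: "Y a = A" "Y (a - 1) = A - \<delta>0" "V (a - 1) = B"
    by (simp_all add: Y_def V_def S0)
  have qd0: "quasi_diff p c y (a - 1) = B"
  proof -
    have "quasi_diff p c y (a - 1)
        = D (a - 1) * \<delta>0 + of_real (c (a - 1)) * of_real (h (a - 1)) * A / e (a - 1)"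
      unfolding quasi_diff_def fwd_diff_def y1 y2 g_def D_def
      by (simp add: Ya algebra_simps add_divide_distrib diff_divide_distrib)
    also have "\<dots> = B" unfolding \<delta>0_def using D[of "a - 1"] by simp
    finally show ?thesis .
  qed
  have qd': "quasi_diff p c y (t - 1) = V (t - 1)" if "t \<ge> a" for t
    using qd[of "t - 1"] qd0 Ya(3) that by (cases "t = a") auto
  have "solves_system a p q c h d lam y"
    unfolding solves_system_iff
  proof (intro conjI allI impI)
    fix t assume t: "t \<ge> a"
    have "quasi_diff p c y t - of_real (h t) * y t $ 2
        = D t * (Y (t + 1) - Y t) + (of_real (c t) - of_real (h t)) * of_real (h t) * Y t / e t"
      unfolding quasi_diff_def fwd_diff_def y1 y2 g_def D_def
      by (simp add: algebra_simps add_divide_distrib diff_divide_distrib)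
    also have "\<dots> = V (t - 1) + (of_real (q t) - lam) * Y t"
      unfolding step(1)[OF t] dl_def using D[of t] t by simp
    finally show "quasi_diff p c y t - of_real (h t) * y t $ 2
        = quasi_diff p c y (t - 1) + (of_real (q t) - lam) * y t $ 1"
      unfolding qd'[OF t] y1 .
  next
    fix t
    show "(lam - of_real (d t)) * y t $ 2
        = of_real (c t) * (y (t + 1) $ 1 - y t $ 1) + of_real (h t) * y t $ 1"
      unfolding y1 y2 g_def using e[of t] by (simp add: e_def)
  qed
  thus ?thesis using qd0 Ya(1) y1 unfolding solves_ivp_def by auto
qed

definition boundary_form ::
    "(int \<Rightarrow> real) \<Rightarrow> (int \<Rightarrow> real) \<Rightarrow> int \<Rightarrow> real \<Rightarrow> (int \<Rightarrow> complex ^ 2) \<Rightarrow> complex"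
  where
  "boundary_form p c N \<beta> y =
     y (N + 1) $ 1 * of_real (cos \<beta>) + quasi_diff p c y N * of_real (sin \<beta>)"

definition weyl_circle ::
    "(int \<Rightarrow> real) \<Rightarrow> (int \<Rightarrow> real) \<Rightarrow> (int \<Rightarrow> complex ^ 2) \<Rightarrow> (int \<Rightarrow> complex ^ 2) \<Rightarrow> int \<Rightarrow> complex set"
  where
  "weyl_circle p c \<phi> \<psi> N =
     {- boundary_form p c N \<beta> \<phi> / boundary_form p c N \<beta> \<psi> | \<beta>. 0 \<le> \<beta> \<and> \<beta> < pi}"

text \<open>
  The closed disc bounded by a circle \<open>C\<close>; its centre and radius are determined by \<open>C\<close>. For sets
  \<open>C\<close> that are not circles the value is the empty set.
\<close>

definition disc_bounded_by :: "complex set \<Rightarrow> complex set"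
  where "disc_bounded_by C = \<Union>{cball z r | z r. 0 < r \<and> sphere z r = C}"

definition circles_converge_to_point :: "int \<Rightarrow> (int \<Rightarrow> complex set) \<Rightarrow> bool"
  where
  "circles_converge_to_point a C \<longleftrightarrow> (\<exists>m. (\<Inter>N\<in>{a<..}. disc_bounded_by (C N)) = {m})"

definition limit_point_case ::
    "int \<Rightarrow> (int \<Rightarrow> real) \<Rightarrow> (int \<Rightarrow> real) \<Rightarrow> (int \<Rightarrow> real) \<Rightarrow> (int \<Rightarrow> real) \<Rightarrow> (int \<Rightarrow> real) \<Rightarrow> bool"
  where
  "limit_point_case a p q c h d \<longleftrightarrow>
     (\<forall>lam \<alpha> \<phi> \<psi>.
        lam \<notin> \<real> \<longrightarrow> 0 \<le> \<alpha> \<longrightarrow> \<alpha> < pi \<longrightarrow>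
        solves_ivp a p q c h d lam (of_real (sin \<alpha>)) (- of_real (cos \<alpha>)) \<phi> \<longrightarrow>
        solves_ivp a p q c h d lam (of_real (cos \<alpha>)) (of_real (sin \<alpha>)) \<psi> \<longrightarrow>
        circles_converge_to_point a (weyl_circle p c \<phi> \<psi>))"

end

theory Submission
  imports Defs
begin

text \<open>
  Fix a nonreal \<open>lam\<close> and put \<open>X\<^sub>m = \<phi> + m \<psi>\<close>. Green's identity describes the disc bounded by the circle
  \<open>C\<^sub>T\<close> as the set of all \<open>m\<close> for which \<open>(Im lam)\<^sup>2\<close> times the partial sum of \<open>|X\<^sub>m|\<^sup>2\<close> up to \<open>T\<close> is at
  most a number that depends on \<open>m\<close> but not on \<open>T\<close> (\<open>weyl_disc\<close>). So the discs are nested, their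
  intersection is not empty, and each of its points \<open>m\<close> has a square summable \<open>X\<^sub>m\<close>. Two different
  points would make \<open>\<phi>\<close> and \<open>\<psi>\<close> both square summable
  (\<open>circles_converge_if_not_all_square_summable\<close>), and it remains to refute this.

  The Wronskian gives \<open>\<phi>\<^sub>1(t) \<psi>\<^sup>[\<^sup>1\<^sup>](t - 1) - \<phi>\<^sup>[\<^sup>1\<^sup>](t - 1) \<psi>\<^sub>1(t) = 1\<close>. Multiply it by the weight
  \<open>w(t) = (p\<^sup>2(t - 1) + c\<^sup>2(t - 1))\<^bsup>-1/4\<^esup> M(t)\<^bsup>-1/2\<^esup>\<close>. If \<open>\<phi>\<close>, \<open>\<psi>\<close> are square summable and
  \<open>w(t) y\<^sup>[\<^sup>1\<^sup>](t - 1)\<close> is square summable for both of them, then the sum of \<open>w\<close> converges, against the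
  divergence hypothesis (\<open>weight_summable_if_all_solutions_square_summable\<close>). Since \<open>|c(t - 1)|\<close> is
  at most a multiple of \<open>M(t)\<close>, square summability of \<open>w(t) y\<^sup>[\<^sup>1\<^sup>](t - 1)\<close> reduces to convergence of the
  energy, the sum of \<open>p(t - 1) |y\<^sub>1(t) - y\<^sub>1(t - 1)|\<^sup>2 / M(t)\<close>
  (\<open>quasi_derivative_weight_summable\<close>).

  The energy is controlled by testing the equation with the conjugate of \<open>y\<^sub>1 / M\<close> and summing by
  parts (\<open>energy_step\<close>, \<open>weighted_energy_summable\<close>). The bound on \<open>M(t) - M(t - 1)\<close> is exactly what
  lets half of the energy absorb the term that contains the difference of \<open>1 / M\<close>. What is left is the
  boundary term \<open>G(t)\<close>, the real part of the conjugate of \<open>y\<^sub>1(t)\<close> times \<open>y\<^sup>[\<^sup>1\<^sup>](t) / M(t)\<close>. A divergent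
  energy would make \<open>G\<close> eventually large, and then \<open>|y\<^sub>1|\<close> would be strictly increasing from some point
  on, which a square summable sequence cannot be.

  The testing produces a term \<open>lam / M(t)\<close>, so this argument needs \<open>M\<close> bounded away from \<open>0\<close>. It is
  applied to \<open>max M 1\<close> in place of \<open>M\<close>. That this keeps the divergence of the sum of weights is the
  content of \<open>weight_summable_if_max_weight_summable\<close>.
\<close>

section \<open>Sums over half-lines of integers\<close>

lemma sum_le_infsum_real:
  fixes f :: "int \<Rightarrow> real"
  assumes "f summable_on A" "finite B" "B \<subseteq> A" "\<And>t. t \<in> A \<Longrightarrow> 0 \<le> f t"
  shows "sum f B \<le> infsum f A"
  using assms by (intro finite_sum_le_infsum) auto

lemma nonneg_summable_on_greaterThanI:
  fixes f :: "int \<Rightarrow> real"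
  assumes nonneg: "\<And>t. N < t \<Longrightarrow> 0 \<le> f t" and bound: "\<And>T. N < T \<Longrightarrow> sum f {N<..T} \<le> B"
  shows "f summable_on {N<..}"
proof (rule nonneg_bdd_above_summable_on)
  show "bdd_above (sum f ` {F. F \<subseteq> {N<..} \<and> finite F})"
  proof (rule bdd_aboveI2)
    fix F assume F: "F \<in> {F. F \<subseteq> {N<..} \<and> finite F}"
    define T where "T = Max (insert (N + 1) F)"
    have "F \<subseteq> {N<..T}" using F by (auto simp: T_def)
    hence "sum f F \<le> sum f {N<..T}"
      using nonneg by (intro sum_mono2) auto
    also have "\<dots> \<le> B" using F by (intro bound) (auto simp: T_def Max_gr_iff)
    finally show "sum f F \<le> B" .
  qed
qed (use nonneg in auto)

lemma summable_on_shift: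
  fixes f :: "int \<Rightarrow> real"
  assumes "f summable_on {N..}"
  shows "(\<lambda>t. f (t - 1)) summable_on {N<..}"
proof -
  have "{N..} = (\<lambda>t. t - 1) ` {N<..}"
    by (auto intro!: image_eqI[of _ "\<lambda>t. t - 1" "_ + 1"])
  moreover have "inj_on (\<lambda>t::int. t - 1) {N<..}" by (simp add: inj_on_def)
  ultimately show ?thesis
    using summable_on_reindex[of "\<lambda>t. t - 1" "{N<..}" f] assms by (simp add: o_def)
qed

lemma finite_if_bounded_below_summable:
  fixes f :: "int \<Rightarrow> real"
  assumes "f summable_on A" "\<And>t. t \<in> A \<Longrightarrow> e \<le> f t" "0 < e"
  shows "finite A"
proof (rule ccontr)
  assume inf: "infinite A"
  obtain n :: nat where n: "infsum f A < n * e"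
    using reals_Archimedean3[OF \<open>0 < e\<close>] by blast
  obtain B where B: "B \<subseteq> A" "finite B" "card B = n"
    using infinite_arbitrarily_large[OF inf] by blast
  have "n * e = (\<Sum>t\<in>B. e)" using B by simp
  also have "\<dots> \<le> sum f B" using B assms(2) by (intro sum_mono) auto
  also have "\<dots> \<le> infsum f A"
    using assms B by (intro sum_le_infsum_real) (auto intro: order_trans less_imp_le)
  finally show False using n by simp
qed

lemma two_mult_le_squares: "2 * (x * y) \<le> x\<^sup>2 + y\<^sup>2" for x y :: real
  using zero_le_power2[of "x - y"] by (simp add: power2_eq_square algebra_simps)

lemma square_summable_has_late_nonincrease:
  fixes v :: "int \<Rightarrow> complex"
  assumes "(\<lambda>t. (cmod (v t))\<^sup>2) summable_on {N..}" "N \<le> T0"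
  shows "\<exists>T\<ge>T0. cmod (v (T + 1)) \<le> cmod (v T)"
proof (rule ccontr)
  assume "\<not> ?thesis"
  hence inc: "cmod (v T) < cmod (v (T + 1))" if "T0 \<le> T" for T using that by force
  have ge: "cmod (v (T0 + 1)) \<le> cmod (v T)" if "T0 + 1 \<le> T" for T
    using that
  proof (induction T rule: int_ge_induct)
    case (step T)
    thus ?case using inc[of T] by simp
  qed simp
  have "finite {T0 + 1..}"
  proof (rule finite_if_bounded_below_summable)
    show "(\<lambda>t. (cmod (v t))\<^sup>2) summable_on {T0 + 1..}"
      by (rule summable_on_subset[OF assms(1)]) (use assms(2) in auto)
    show "(cmod (v (T0 + 1)))\<^sup>2 \<le> (cmod (v t))\<^sup>2" if "t \<in> {T0 + 1..}" for t
      using ge[of t] that by (intro power_mono) auto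
    have "0 < cmod (v (T0 + 1))" using inc[of T0] norm_ge_zero[of "v T0"] by linarith
    thus "0 < (cmod (v (T0 + 1)))\<^sup>2" by simp
  qed
  thus False by (simp add: infinite_Ici)
qed

definition square_summable :: "int \<Rightarrow> (int \<Rightarrow> complex ^ 2) \<Rightarrow> bool"
  where "square_summable a y \<longleftrightarrow> (\<lambda>t. (cmod (y t $ 1))\<^sup>2 + (cmod (y t $ 2))\<^sup>2) summable_on {a..}"

lemma square_summable_linear:
  assumes "square_summable a y" "square_summable a z"
  shows "square_summable a (\<lambda>t. k *s y t + l *s z t)"
  unfolding square_summable_def
proof (rule summable_on_comparison_test)
  let ?R = "\<lambda>y t. (cmod (y t $ 1))\<^sup>2 + (cmod (y t $ 2))\<^sup>2"
  show "(\<lambda>t. (2 * (cmod k)\<^sup>2) * ?R y t + (2 * (cmod l)\<^sup>2) * ?R z t) summable_on {a..}"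
    by (rule summable_on_add; rule summable_on_cmult_right)
      (use assms in \<open>simp_all add: square_summable_def\<close>)
  have *: "(cmod (k * b + l * b'))\<^sup>2 \<le> 2 * (cmod k)\<^sup>2 * (cmod b)\<^sup>2 + 2 * (cmod l)\<^sup>2 * (cmod b')\<^sup>2" for b b'
  proof -
    have "(cmod (k * b + l * b'))\<^sup>2 \<le> (cmod (k * b) + cmod (l * b'))\<^sup>2"
      by (intro power_mono norm_triangle_ineq) simp
    also have "\<dots> \<le> 2 * (cmod (k * b))\<^sup>2 + 2 * (cmod (l * b'))\<^sup>2"
      using two_mult_le_squares[of "cmod (k * b)" "cmod (l * b')"] by (simp add: power2_sum)
    finally show ?thesis by (simp add: norm_mult power_mult_distrib)
  qed
  show "?R (\<lambda>t. k *s y t + l *s z t) t \<le> (2 * (cmod k)\<^sup>2) * ?R y t + (2 * (cmod l)\<^sup>2) * ?R z t" for t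
    using *[of "y t $ 1" "z t $ 1"] *[of "y t $ 2" "z t $ 2"] by (simp add: algebra_simps)
qed auto

section \<open>Green's identities\<close>

text \<open>
  The increment of the left-hand side is a bilinear expression in \<open>y\<close>, \<open>z\<close> minus the one with \<open>y\<close> and \<open>z\<close>
  exchanged. It vanishes because the expression is symmetric. For the terms with \<open>p\<close> and \<open>q - lam\<close> this
  is evident, and the second equation of the system turns the terms with \<open>c\<close> and \<open>h\<close>,
  \<open>(c \<Delta>y\<^sub>1 + h y\<^sub>1) z\<^sub>2\<close>, into \<open>(lam - d) y\<^sub>2 z\<^sub>2\<close>.
\<close>

lemma wronskian_constant:
  assumes y: "solves_system a p q c h d lam y" and z: "solves_system a p q c h d lam z" and "a \<le> t"
  shows "y t $ 1 * quasi_diff p c z (t - 1) - quasi_diff p c y (t - 1) * z t $ 1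
       = y a $ 1 * quasi_diff p c z (a - 1) - quasi_diff p c y (a - 1) * z a $ 1"
  using \<open>a \<le> t\<close>
proof (induction t rule: int_ge_induct)
  case base
  show ?case ..
next
  case (step t)
  define Y where "Y = quasi_diff p c y"
  define Z where "Z = quasi_diff p c z"
  have Y: "Y t - of_real (h t) * y t $ 2 = Y (t - 1) + (of_real (q t) - lam) * y t $ 1"
    and Z: "Z t - of_real (h t) * z t $ 2 = Z (t - 1) + (of_real (q t) - lam) * z t $ 1"
    and "(lam - of_real (d t)) * y t $ 2
             = of_real (c t) * (y (t + 1) $ 1 - y t $ 1) + of_real (h t) * y t $ 1"
    and "(lam - of_real (d t)) * z t $ 2
             = of_real (c t) * (z (t + 1) $ 1 - z t $ 1) + of_real (h t) * z t $ 1"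
    and "Y t = of_real (p t) * (y (t + 1) $ 1 - y t $ 1) + of_real (c t) * y t $ 2"
    and "Z t = of_real (p t) * (z (t + 1) $ 1 - z t $ 1) + of_real (c t) * z t $ 2"
    using y z step(1) unfolding solves_system_iff Y_def Z_def
    by (auto simp: quasi_diff_def fwd_diff_def)
  hence "y (t + 1) $ 1 * Z t - Y t * z (t + 1) $ 1 = y t $ 1 * Z (t - 1) - Y (t - 1) * z t $ 1"
    by algebra
  then show ?case using step by (simp add: Y_def Z_def)
qed

text \<open>
  The same computation with the conjugate of \<open>y\<close> in one place: everything except \<open>- lam |y\<^sub>1|\<^sup>2\<close> and
  \<open>cnj lam |y\<^sub>2|\<^sup>2\<close> is real, and both have imaginary part \<open>- Im lam\<close> times a square.
\<close>

lemma lagrange_step: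
  assumes y: "solves_system a p q c h d lam y" and t: "a \<le> t"
  shows "Im (cnj (y (t + 1) $ 1) * quasi_diff p c y t)
       = Im (cnj (y t $ 1) * quasi_diff p c y (t - 1))
         - Im lam * ((cmod (y t $ 1))\<^sup>2 + (cmod (y t $ 2))\<^sup>2)"
proof -
  define v w u where "v = y t $ 1" and "w = y (t + 1) $ 1" and "u = y t $ 2"
  define Y where "Y = quasi_diff p c y"
  have Y: "Y t - of_real (h t) * u = Y (t - 1) + (of_real (q t) - lam) * v"
    and U: "(lam - of_real (d t)) * u = of_real (c t) * (w - v) + of_real (h t) * v"
    and Yt: "Y t = of_real (p t) * (w - v) + of_real (c t) * u"
    using y t unfolding solves_system_iff Y_def v_def w_def u_def
    by (auto simp: quasi_diff_def fwd_diff_def)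
  have U': "cnj (lam - of_real (d t)) * cnj u = of_real (c t) * cnj (w - v) + of_real (h t) * cnj v"
    using arg_cong[OF U, of cnj] by simp
  have "cnj w * Y t - cnj v * Y (t - 1) = cnj (w - v) * Y t + cnj v * (Y t - Y (t - 1))"
    by (simp add: algebra_simps)
  also have "\<dots> = of_real (p t) * ((w - v) * cnj (w - v)) + (of_real (q t) - lam) * (v * cnj v)
              + u * (of_real (c t) * cnj (w - v) + of_real (h t) * cnj v)"
  proof -
    have Y1: "Y t - Y (t - 1) = (of_real (q t) - lam) * v + of_real (h t) * u"
      using Y by (simp add: algebra_simps)
    show ?thesis
      unfolding Y1 unfolding Yt by (simp add: algebra_simps)
  qed
  also have "\<dots> = of_real (p t) * ((w - v) * cnj (w - v)) + (of_real (q t) - lam) * (v * cnj v)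
              + (cnj lam - of_real (d t)) * (u * cnj u)"
    unfolding U'[symmetric] by (simp add: algebra_simps)
  finally have "Im (cnj w * Y t - cnj v * Y (t - 1)) = Im \<dots>"
    by (rule arg_cong)
  also have "\<dots> = - Im lam * ((cmod v)\<^sup>2 + (cmod u)\<^sup>2)"
    unfolding complex_norm_square[symmetric] by (simp add: algebra_simps)
  finally have "Im (cnj w * Y t - cnj v * Y (t - 1)) = - Im lam * ((cmod v)\<^sup>2 + (cmod u)\<^sup>2)" .
  thus ?thesis by (simp add: v_def w_def u_def Y_def algebra_simps)
qed

lemma lagrange_identity:
  assumes y: "solves_system a p q c h d lam y" and T: "a - 1 \<le> T"
  shows "Im (cnj (y (T + 1) $ 1) * quasi_diff p c y T)
       = Im (cnj (y a $ 1) * quasi_diff p c y (a - 1))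
         - Im lam * (\<Sum>t = a..T. (cmod (y t $ 1))\<^sup>2 + (cmod (y t $ 2))\<^sup>2)"
  using T
proof (induction T rule: int_ge_induct)
  case base
  show ?case by simp
next
  case (step T)
  have "{a..T + 1} = insert (T + 1) {a..T}" using step(1) by auto
  thus ?case
    using step(2) lagrange_step[OF y, of "T + 1"] step(1) by (simp add: algebra_simps)
qed

lemma solves_system_linear:
  assumes y: "solves_system a p q c h d lam y" and z: "solves_system a p q c h d lam z"
  shows "solves_system a p q c h d lam (\<lambda>t. y t + m *s z t)"
    and "quasi_diff p c (\<lambda>t. y t + m *s z t) t = quasi_diff p c y t + m * quasi_diff p c z t"
proof -
  show qw: "quasi_diff p c (\<lambda>t. y t + m *s z t) t = quasi_diff p c y t + m * quasi_diff p c z t" for t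
    by (simp add: quasi_diff_def fwd_diff_def algebra_simps)
  have sub: "(x + m * x') - k * (y + m * y') = (u + m * u') + l * (v + m * v')"
    if "x - k * y = u + l * v" "x' - k * y' = u' + l * v'"
    for x x' y y' u u' v v' k l m :: complex
    using that by algebra
  have sub': "k * (x + n * x') = l * ((u + n * u') - (v + n * v')) + m * (v + n * v')"
    if "k * x = l * (u - v) + m * v" "k * x' = l * (u' - v') + m * v'"
    for x x' u u' v v' k l m n :: complex
    using that by algebra
  show "solves_system a p q c h d lam (\<lambda>t. y t + m *s z t)"
    using y z unfolding solves_system_iff qw
    by (auto intro!: sub sub')
qed

section \<open>Weyl discs\<close>

text \<open>
  By Krein--Milman a ball is the convex hull of its boundary sphere, so the sphere determines the
  ball, hence centre and radius.
\<close>

lemma sphere_eq_complex: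
  fixes z z' :: complex
  assumes r: "0 < r" "0 < r'" and eq: "sphere z r = sphere z' r'"
  shows "z = z' \<and> r = r'"
proof -
  have c: "cball z r = cball z' r'"
    if "\<And>(z::complex) r. 0 < r \<Longrightarrow> cball z r = convex hull (sphere z r)"
    using that r eq by metis
  have "cball w s = convex hull (sphere w s)" if "0 < s" for w :: complex and s
    using that Krein_Milman_frontier[of "cball w s"] by (simp)
  from c[OF this] show ?thesis using r by (simp add: cball_eq_cball_iff)
qed

lemma disc_bounded_by_sphere:
  assumes "0 < r"
  shows "disc_bounded_by (sphere z r) = cball z r"
  using sphere_eq_complex assms unfolding disc_bounded_by_def by blast

text \<open>
  A point \<open>m\<close> is of the given form for a real \<open>\<beta>\<close> iff \<open>u + m w\<close> and \<open>v + m x\<close> are linearly dependent over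
  the reals, that is, iff \<open>F m = Im (cnj (u + m w) (v + m x))\<close> vanishes. As a function of \<open>m\<close>, \<open>F\<close> is a
  real quadratic polynomial with leading part \<open>k |m|\<^sup>2\<close>. Completing the square shows that its zeros form
  a circle, whose radius is positive because the determinant \<open>u x - v w\<close> is not \<open>0\<close>.
\<close>

lemma weyl_circle_geometry:
  fixes u v w x :: complex
  defines "k \<equiv> Im (cnj w * x)"
  assumes D: "u * x - v * w \<noteq> 0" and k: "k \<noteq> 0"
  obtains z r where "0 < r"
    "{- (u * of_real (cos \<beta>) + v * of_real (sin \<beta>)) / (w * of_real (cos \<beta>) + x * of_real (sin \<beta>))
        | \<beta>. 0 \<le> \<beta> \<and> \<beta> < pi} = sphere z r"
    "\<And>m. m \<in> cball z r \<longleftrightarrow> k * Im (cnj (u + m * w) * (v + m * x)) \<le> 0"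
proof -
  define B where "B = cnj u * x - w * cnj v"
  \<comment> \<open>Centre and radius come from completing the square in \<open>F m = k |m|\<^sup>2 + Im (m B) + F 0\<close>.\<close>
  define z where "z = - \<i> * cnj B / of_real (2 * k)"
  define r where "r = cmod (u * x - v * w) / (2 * \<bar>k\<bar>)"
  define F where "F m = Im (cnj (u + m * w) * (v + m * x))" for m
  have r: "0 < r" using D k by (simp add: r_def)
  have F: "F m = k * ((dist z m)\<^sup>2 - r\<^sup>2)" for m
  proof -
    have Dn: "(cmod (u * x - v * w))\<^sup>2 = (cmod B)\<^sup>2 - 4 * k * Im (cnj u * v)"
      unfolding cmod_power2 B_def k_def by (simp add: power2_eq_square algebra_simps)
    have "F m = k * (cmod m)\<^sup>2 + Im (m * B) + Im (cnj u * v)"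
      unfolding cmod_power2 B_def k_def F_def by (simp add: power2_eq_square algebra_simps)
    also have "\<dots> = k * ((cmod (z - m))\<^sup>2 - (cmod z)\<^sup>2) + Im (cnj u * v)"
    proof -
      have "Re z = - Im B / (2 * k)" "Im z = - Re B / (2 * k)"
        unfolding z_def by (simp_all add: Re_divide_of_real Im_divide_of_real del: of_real_mult)
      hence "2 * k * Re z = - Im B" "2 * k * Im z = - Re B" using k by simp_all
      moreover have "k * ((cmod (z - m))\<^sup>2 - (cmod z)\<^sup>2)
           = k * (cmod m)\<^sup>2 - Re m * (2 * k * Re z) - Im m * (2 * k * Im z)"
        unfolding cmod_power2 by (simp add: power2_eq_square algebra_simps)
      ultimately show ?thesis by simp
    qed
    also have "(cmod z)\<^sup>2 = r\<^sup>2 + Im (cnj u * v) / k"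
    proof -
      have "(cmod z)\<^sup>2 = (cmod B)\<^sup>2 / (2 * k)\<^sup>2"
        by (simp add: z_def norm_divide norm_mult power_divide del: of_real_mult)
      also have "r\<^sup>2 = ((cmod B)\<^sup>2 - 4 * k * Im (cnj u * v)) / (2 * k)\<^sup>2"
        unfolding Dn[symmetric] by (simp add: r_def power_divide)
      moreover have "b / (2 * k)\<^sup>2 = (b - 4 * k * s) / (2 * k)\<^sup>2 + s / k" for b s :: real
        using k by (simp add: field_simps power2_eq_square)
      ultimately show ?thesis by simp
    qed
    also have "k * (b - (b' + s / k)) + s = k * (b - b')" for b b' s :: real
      using k by (simp add: field_simps)
    finally show ?thesis by (simp only: dist_norm)
  qed
  have "m \<in> cball z r \<longleftrightarrow> k * F m \<le> 0" for m
  proof -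
    have "k * F m \<le> 0 \<longleftrightarrow> k\<^sup>2 * ((dist z m)\<^sup>2 - r\<^sup>2) \<le> 0"
      by (simp add: F power2_eq_square mult.assoc)
    also have "\<dots> \<longleftrightarrow> (dist z m)\<^sup>2 \<le> r\<^sup>2"
      using k by (simp add: mult_le_0_iff)
    also have "\<dots> \<longleftrightarrow> dist z m \<le> r"
      using r by (simp add: power2_le_iff_abs_le)
    finally show ?thesis by simp
  qed
  moreover have "{- (u * of_real (cos \<beta>) + v * of_real (sin \<beta>))
      / (w * of_real (cos \<beta>) + x * of_real (sin \<beta>)) | \<beta>. 0 \<le> \<beta> \<and> \<beta> < pi} = sphere z r" (is "?C = _")
  proof -
    have sph: "m \<in> sphere z r \<longleftrightarrow> F m = 0" for m
      using k r by (simp add: F power2_eq_iff_nonneg)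
    have real_ratio: "Im (cnj P * Q) = 0" if "P * of_real s + Q * of_real s' = 0" "s \<noteq> 0 \<or> s' \<noteq> 0"
      for P Q :: complex and s s' :: real
    proof -
      have e: "Re P * s + Re Q * s' = 0" "Im P * s + Im Q * s' = 0"
        using that(1) by (simp_all add: complex_eq_iff)
      have im: "Im (cnj P * Q) = Re P * Im Q - Im P * Re Q" by simp
      have "s * Im (cnj P * Q) = 0"
        using e unfolding im by algebra
      moreover have "s' * Im (cnj P * Q) = 0"
        using e unfolding im by algebra
      ultimately have "s * Im (cnj P * Q) = 0" "s' * Im (cnj P * Q) = 0" by blast+
      thus ?thesis using that(2) by auto
    qed
    have cs: "cos \<beta> \<noteq> 0 \<or> sin \<beta> \<noteq> 0" for \<beta> :: real
      using sin_zero_norm_cos_one[of \<beta>] by auto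
    have den: "w * of_real (cos \<beta>) + x * of_real (sin \<beta>) \<noteq> 0" for \<beta>
      using real_ratio[of w "cos \<beta>" x "sin \<beta>"] cs k unfolding k_def by auto
    show ?thesis
    proof (intro set_eqI iffI)
      fix m assume "m \<in> ?C"
      then obtain \<beta> where "m = - (u * of_real (cos \<beta>) + v * of_real (sin \<beta>))
          / (w * of_real (cos \<beta>) + x * of_real (sin \<beta>))" by blast
      hence "(u + m * w) * of_real (cos \<beta>) + (v + m * x) * of_real (sin \<beta>) = 0"
        using den[of \<beta>] by (simp add: field_simps)
      from real_ratio[OF this cs] show "m \<in> sphere z r" by (simp only: sph F_def)
    next
      fix m assume "m \<in> sphere z r"
      hence F0: "Im (cnj (u + m * w) * (v + m * x)) = 0" by (simp only: sph F_def)
      define P where "P = u + m * w"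
      define Q where "Q = v + m * x"
      have F0: "Im (cnj P * Q) = 0" using F0 by (simp only: P_def Q_def)
      have "\<exists>\<beta>. 0 \<le> \<beta> \<and> \<beta> < pi \<and> P * of_real (cos \<beta>) + Q * of_real (sin \<beta>) = 0"
      proof (cases "P = 0")
        case True
        thus ?thesis by (intro exI[of _ 0]) simp
      next
        case False
        have "Q / P \<in> \<real>"
          using F0 by (simp add: complex_is_Real_iff Im_divide algebra_simps)
        then obtain \<rho> where "Q / P = of_real \<rho>" by (auto elim: Reals_cases)
        hence Q: "Q = of_real \<rho> * P" using False by (simp add: field_simps)
        \<comment> \<open>The required \<open>\<beta>\<close> satisfies \<open>cot \<beta> = - \<rho>\<close>.\<close>
        define b where "b = arctan \<rho>"
        have b: "- (pi / 2) < b" "b < pi / 2" "sin b = \<rho> * cos b"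
          using tan_arctan[of \<rho>] cos_arctan_not_zero[of \<rho>] arctan_lbound[of \<rho>] arctan_ubound[of \<rho>]
          unfolding b_def tan_def by (simp_all add: field_simps)
        have "P * of_real (cos (pi / 2 + b)) + Q * of_real (sin (pi / 2 + b)) = 0"
          by (simp add: cos_add sin_add Q b(3))
        thus ?thesis using b by (intro exI[of _ "pi / 2 + b"]) auto
      qed
      then obtain \<beta> where \<beta>: "0 \<le> \<beta>" "\<beta> < pi" "P * of_real (cos \<beta>) + Q * of_real (sin \<beta>) = 0"
        by blast
      have "m * (w * of_real (cos \<beta>) + x * of_real (sin \<beta>)) = - (u * of_real (cos \<beta>) + v * of_real (sin \<beta>))"
        using \<beta>(3) unfolding P_def Q_def by algebra
      hence "m = - (u * of_real (cos \<beta>) + v * of_real (sin \<beta>)) / (w * of_real (cos \<beta>) + x * of_real (sin \<beta>))"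
        using den[of \<beta>] by (simp add: field_simps)
      thus "m \<in> ?C" using \<beta>(1,2) by blast
    qed
  qed
  ultimately show ?thesis using that r unfolding F_def by blast
qed

text \<open>
  The points of the disc are those for which \<open>- Im lam\<close> times the boundary value
  \<open>Im (cnj (X\<^sub>1(N + 1)) X\<^sup>[\<^sup>1\<^sup>](N))\<close> of \<open>X = \<phi> + m \<psi>\<close> is not positive. The Lagrange identity expresses this
  boundary value by the one at the left end point and the partial sum of \<open>|X|\<^sup>2\<close>.
\<close>

lemma weyl_disc:
  assumes lam: "lam \<notin> \<real>" and N: "a < N"
    and \<phi>: "solves_system a p q c h d lam \<phi>" and \<psi>: "solves_system a p q c h d lam \<psi>"
    and wronskian: "\<phi> a $ 1 * quasi_diff p c \<psi> (a - 1) - quasi_diff p c \<phi> (a - 1) * \<psi> a $ 1 = 1"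
    and real: "Im (cnj (\<psi> a $ 1) * quasi_diff p c \<psi> (a - 1)) = 0"
  shows "\<exists>z r. 0 < r \<and> disc_bounded_by (weyl_circle p c \<phi> \<psi> N) = cball z r"
    and "m \<in> disc_bounded_by (weyl_circle p c \<phi> \<psi> N) \<longleftrightarrow>
      (Im lam)\<^sup>2 * (\<Sum>t = a..N. (cmod ((\<phi> t + m *s \<psi> t) $ 1))\<^sup>2 + (cmod ((\<phi> t + m *s \<psi> t) $ 2))\<^sup>2)
      \<le> Im lam * Im (cnj (\<phi> a $ 1 + m * \<psi> a $ 1)
          * (quasi_diff p c \<phi> (a - 1) + m * quasi_diff p c \<psi> (a - 1)))"
proof -
  have lam0: "Im lam \<noteq> 0" using lam by (simp add: complex_is_Real_iff)
  define S where "S y = (\<Sum>t = a..N. (cmod (y t $ 1))\<^sup>2 + (cmod (y t $ 2))\<^sup>2)" for y :: "int \<Rightarrow> complex ^ 2"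
  define k where "k = Im (cnj (\<psi> (N + 1) $ 1) * quasi_diff p c \<psi> N)"
  have k: "k = - Im lam * S \<psi>"
    using lagrange_identity[OF \<psi>, of N] N real by (simp add: k_def S_def)
  \<comment> \<open>If \<open>\<psi>\<close> vanished on \<open>{a..N}\<close>, where \<open>a < N\<close>, then also \<open>\<psi>\<^sup>[\<^sup>1\<^sup>](a)\<close> and \<open>\<psi>\<^sup>[\<^sup>1\<^sup>](a - 1)\<close> would be \<open>0\<close>,
    against the value of the Wronskian.\<close>
  have S: "0 < S \<psi>"
  proof (rule ccontr)
    assume "\<not> 0 < S \<psi>"
    moreover have "0 \<le> S \<psi>" unfolding S_def by (intro sum_nonneg) auto
    ultimately have "S \<psi> = 0" by simp
    hence "\<forall>t\<in>{a..N}. (cmod (\<psi> t $ 1))\<^sup>2 + (cmod (\<psi> t $ 2))\<^sup>2 = 0"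
      unfolding S_def by (subst (asm) sum_nonneg_eq_0_iff) auto
    hence z: "\<psi> t $ 1 = 0 \<and> \<psi> t $ 2 = 0" if "t \<in> {a..N}" for t
      using that by (auto simp: add_nonneg_eq_0_iff)
    have "quasi_diff p c \<psi> a = 0"
      using z[of a] z[of "a + 1"] N by (simp add: quasi_diff_def fwd_diff_def)
    hence "quasi_diff p c \<psi> (a - 1) = 0"
      using \<psi> z[of a] N unfolding solves_system_iff by auto
    thus False using wronskian z[of a] N by simp
  qed
  have k0: "k \<noteq> 0" using k S lam0 by simp
  have W: "\<phi> (N + 1) $ 1 * quasi_diff p c \<psi> N - quasi_diff p c \<phi> N * \<psi> (N + 1) $ 1 \<noteq> 0"
    using wronskian_constant[OF \<phi> \<psi>, of "N + 1"] wronskian N by simp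
  obtain z r where zr: "0 < r" "weyl_circle p c \<phi> \<psi> N = sphere z r"
    "\<And>m. m \<in> cball z r \<longleftrightarrow> k * Im (cnj (\<phi> (N + 1) $ 1 + m * \<psi> (N + 1) $ 1)
        * (quasi_diff p c \<phi> N + m * quasi_diff p c \<psi> N)) \<le> 0"
    by (rule weyl_circle_geometry[OF W k0[unfolded k_def]])
      (auto simp only: k_def weyl_circle_def boundary_form_def)
  have disc: "disc_bounded_by (weyl_circle p c \<phi> \<psi> N) = cball z r"
    using zr(1,2) by (simp add: disc_bounded_by_sphere)
  thus "\<exists>z r. 0 < r \<and> disc_bounded_by (weyl_circle p c \<phi> \<psi> N) = cball z r" using zr(1) by blast
  define \<eta> where "\<eta> = (\<lambda>t. \<phi> t + m *s \<psi> t)"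
  note lin = solves_system_linear[OF \<phi> \<psi>, of m, folded \<eta>_def]
  define F where "F t = Im (cnj (\<phi> (t + 1) $ 1 + m * \<psi> (t + 1) $ 1)
        * (quasi_diff p c \<phi> t + m * quasi_diff p c \<psi> t))" for t
  have F: "F N = F (a - 1) - Im lam * S \<eta>"
    using lagrange_identity[OF lin(1), of N] N unfolding lin(2) F_def S_def by (simp add: \<eta>_def)
  have "m \<in> cball z r \<longleftrightarrow> k * F N \<le> 0" unfolding zr(3) F_def ..
  also have "\<dots> \<longleftrightarrow> S \<psi> * (- (Im lam * F N)) \<le> 0" by (simp add: k algebra_simps)
  also have "\<dots> \<longleftrightarrow> 0 \<le> Im lam * F N"
    using S by (auto simp: zero_le_mult_iff mult_le_0_iff)
  also have "\<dots> \<longleftrightarrow> (Im lam)\<^sup>2 * S \<eta> \<le> Im lam * F (a - 1)"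
    unfolding F by (simp add: right_diff_distrib power2_eq_square mult.assoc)
  finally show "m \<in> disc_bounded_by (weyl_circle p c \<phi> \<psi> N) \<longleftrightarrow>
      (Im lam)\<^sup>2 * (\<Sum>t = a..N. (cmod ((\<phi> t + m *s \<psi> t) $ 1))\<^sup>2 + (cmod ((\<phi> t + m *s \<psi> t) $ 2))\<^sup>2)
      \<le> Im lam * Im (cnj (\<phi> a $ 1 + m * \<psi> a $ 1)
          * (quasi_diff p c \<phi> (a - 1) + m * quasi_diff p c \<psi> (a - 1)))"
    unfolding disc S_def \<eta>_def F_def by simp
qed

lemma circles_converge_if_not_all_square_summable:
  assumes lam: "lam \<notin> \<real>"
    and \<phi>: "solves_system a p q c h d lam \<phi>" and \<psi>: "solves_system a p q c h d lam \<psi>"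
    and wronskian: "\<phi> a $ 1 * quasi_diff p c \<psi> (a - 1) - quasi_diff p c \<phi> (a - 1) * \<psi> a $ 1 = 1"
    and real: "Im (cnj (\<psi> a $ 1) * quasi_diff p c \<psi> (a - 1)) = 0"
    and not_l2: "\<not> (square_summable a \<phi> \<and> square_summable a \<psi>)"
  shows "circles_converge_to_point a (weyl_circle p c \<phi> \<psi>)"
proof -
  have lam0: "0 < (Im lam)\<^sup>2" using lam by (simp add: complex_is_Real_iff)
  define D where "D N = disc_bounded_by (weyl_circle p c \<phi> \<psi> N)" for N
  define \<eta> where "\<eta> m t = \<phi> t + m *s \<psi> t" for m t
  define f where "f m t = (cmod (\<eta> m t $ 1))\<^sup>2 + (cmod (\<eta> m t $ 2))\<^sup>2" for m t
  define bnd where "bnd m = Im lam * Im (cnj (\<phi> a $ 1 + m * \<psi> a $ 1)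
          * (quasi_diff p c \<phi> (a - 1) + m * quasi_diff p c \<psi> (a - 1)))" for m
  have f0: "0 \<le> f m t" for m t by (simp add: f_def)
  note disc = weyl_disc[OF lam _ \<phi> \<psi> wronskian real]
  have cball: "\<exists>z r. 0 < r \<and> D N = cball z r" if "a < N" for N
    using disc(1)[OF that] by (simp add: D_def)
  have mem: "m \<in> D N \<longleftrightarrow> (Im lam)\<^sup>2 * sum (f m) {a..N} \<le> bnd m" if "a < N" for N m
    using disc(2)[OF that] by (simp add: D_def f_def bnd_def \<eta>_def)
  have nested: "D N' \<subseteq> D N" if "a < N" "N \<le> N'" for N N'
  proof
    fix m assume "m \<in> D N'"
    hence "(Im lam)\<^sup>2 * sum (f m) {a..N'} \<le> bnd m" using mem that by simp
    moreover have "sum (f m) {a..N} \<le> sum (f m) {a..N'}"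
      using that f0 by (intro sum_mono2) auto
    ultimately show "m \<in> D N" using mem[of N m] that lam0
      by (meson mult_left_mono less_imp_le order_trans)
  qed
  have "(\<Inter>n::nat. D (a + 1 + int n)) \<noteq> {}"
  proof (rule compact_nest)
    fix n :: nat
    obtain z r where "0 < r" "D (a + 1 + int n) = cball z r" using cball[of "a + 1 + int n"] by auto
    thus "compact (D (a + 1 + int n))" "D (a + 1 + int n) \<noteq> {}" by auto
  qed (rule nested, auto)
  then obtain m0 where m0: "m0 \<in> D (a + 1 + int n)" for n by blast
  have "m0 \<in> D N" if "a < N" for N
    using m0[of "nat (N - a - 1)"] that by simp
  moreover have "m = m0" if "\<forall>N>a. m \<in> D N" for m
  proof (rule ccontr)
    assume ne: "m \<noteq> m0"
    have l2: "square_summable a (\<eta> k)" if k: "\<forall>N>a. k \<in> D N" for k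
    proof -
      have "f k summable_on {a<..}"
      proof (rule nonneg_summable_on_greaterThanI)
        show "sum (f k) {a<..T} \<le> bnd k / (Im lam)\<^sup>2" if "a < T" for T
        proof -
          have "sum (f k) {a<..T} \<le> sum (f k) {a..T}"
            using f0 by (intro sum_mono2) auto
          also have "\<dots> \<le> bnd k / (Im lam)\<^sup>2"
            using mem[of T k] k that lam0 by (simp add: pos_le_divide_eq mult.commute)
          finally show ?thesis .
        qed
      qed (rule f0)
      hence "f k summable_on insert a {a<..}" by (simp add: summable_on_insert_iff)
      moreover have "insert a {a<..} = {a..}" by auto
      ultimately show ?thesis by (simp add: square_summable_def f_def[abs_def])
    qed
    have l2m: "square_summable a (\<eta> m)" "square_summable a (\<eta> m0)"
      using l2 that calculation by auto
    \<comment> \<open>\<open>\<psi>\<close> and \<open>\<phi>\<close> are the combinations \<open>e (X\<^sub>m - X\<^sub>m\<^sub>0)\<close> and \<open>e (m X\<^sub>m\<^sub>0 - m0 X\<^sub>m)\<close>.\<close>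
    define e where "e = inverse (m - m0)"
    have e: "e * (m - m0) = 1" using ne by (simp add: e_def)
    have "square_summable a (\<lambda>t. e *s \<eta> m t + (- e) *s \<eta> m0 t)"
      by (rule square_summable_linear[OF l2m])
    also have "(\<lambda>t. e *s \<eta> m t + (- e) *s \<eta> m0 t) = (\<lambda>t. (e * (m - m0)) *s \<psi> t)"
      by (simp add: \<eta>_def fun_eq_iff vec_eq_iff algebra_simps)
    finally have "square_summable a \<psi>" by (simp add: e)
    moreover have "square_summable a (\<lambda>t. (- (e * m0)) *s \<eta> m t + (e * m) *s \<eta> m0 t)"
      by (rule square_summable_linear[OF l2m])
    moreover have "(\<lambda>t. (- (e * m0)) *s \<eta> m t + (e * m) *s \<eta> m0 t) = (\<lambda>t. (e * (m - m0)) *s \<phi> t)"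
      by (simp add: \<eta>_def fun_eq_iff vec_eq_iff algebra_simps)
    ultimately have "square_summable a \<phi>" "square_summable a \<psi>" by (simp_all add: e)
    thus False using not_l2 by simp
  qed
  ultimately have "(\<Inter>N\<in>{a<..}. D N) = {m0}" by auto
  thus ?thesis unfolding circles_converge_to_point_def D_def by blast
qed

section \<open>Replacing M by max M 1\<close>

text \<open>
  This is the meaning of the third hypothesis of the theorem: \<open>M\<^bsup>-1/2\<^esup>\<close> grows by at most
  \<open>k4 p(t - 1)\<^bsup>-1/2\<^esup>\<close> in each step.
\<close>

lemma inv_sqrt_lipschitz:
  fixes x y P k :: real
  assumes "0 < x" "0 < y" "0 < P" and c: "sqrt P * \<bar>y - x\<bar> / (sqrt y * x) \<le> k"
  shows "1 / sqrt y - 1 / sqrt x \<le> k / sqrt P"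
proof -
  define s t r where "s = sqrt x" and "t = sqrt y" and "r = sqrt P"
  have pos: "0 < s" "0 < t" "0 < r" and sq: "x = s\<^sup>2" "y = t\<^sup>2"
    using assms by (simp_all add: s_def t_def r_def)
  have k: "r * \<bar>t\<^sup>2 - s\<^sup>2\<bar> / (t * s\<^sup>2) \<le> k"
    using c by (simp add: sq r_def) (use pos in simp)
  have k0: "0 \<le> r * \<bar>t\<^sup>2 - s\<^sup>2\<bar> / (t * s\<^sup>2)" using pos by simp
  have "1 / t - 1 / s = (s - t) / (s * t)" using pos by (simp add: field_simps)
  also have "\<dots> \<le> \<bar>t\<^sup>2 - s\<^sup>2\<bar> / (t * s\<^sup>2)"
  proof (cases "s \<le> t")
    case True
    hence "(s - t) / (s * t) \<le> 0" using pos by (simp add: divide_nonpos_pos)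
    also have "0 \<le> \<bar>t\<^sup>2 - s\<^sup>2\<bar> / (t * s\<^sup>2)" using pos by simp
    finally show ?thesis .
  next
    case False
    have "(s - t) / (s * t) = (s - t) * s / (t * s\<^sup>2)"
      using pos by (simp add: power2_eq_square)
    also have "\<dots> \<le> (s - t) * (s + t) / (t * s\<^sup>2)"
      using pos False by (intro divide_right_mono mult_left_mono) auto
    also have "(s - t) * (s + t) = \<bar>t\<^sup>2 - s\<^sup>2\<bar>"
    proof -
      have "t\<^sup>2 \<le> s\<^sup>2" using pos False by (intro power_mono) auto
      thus ?thesis by (simp add: power2_eq_square algebra_simps)
    qed
    finally show ?thesis .
  qed
  also have "\<dots> = (r * \<bar>t\<^sup>2 - s\<^sup>2\<bar> / (t * s\<^sup>2)) / r" using pos by simp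
  also have "\<dots> \<le> k / r" using k pos by (intro divide_right_mono) auto
  finally show ?thesis by (simp add: s_def t_def r_def)
qed

text \<open>
  On the set \<open>A\<close> where \<open>M < 1\<close> the hypothesis says that \<open>\<rho>\<close> is summable. There \<open>c\<close> is bounded, so \<open>\<rho>\<close> is
  comparable with \<open>p(t - 1)\<^bsup>-1/2\<^esup>\<close> except where \<open>p(t - 1) < 1\<close>, and that happens only finitely often
  because \<open>\<rho>\<close> is then bounded below. So \<open>p(t - 1)\<^bsup>-1/2\<^esup>\<close> is summable over \<open>A\<close>. By
  \<open>inv_sqrt_lipschitz\<close>, \<open>max (M\<^bsup>-1/2\<^esup>) 1\<close> can increase only at points of \<open>A\<close>, hence by a
  finite total amount. It is therefore bounded, and the two weights differ by a bounded factor.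
\<close>

lemma weight_summable_if_max_weight_summable:
  fixes p c M :: "int \<Rightarrow> real"
  defines "\<rho> \<equiv> \<lambda>t. 1 / ((p (t - 1))\<^sup>2 + (c (t - 1))\<^sup>2) powr (1 / 4)"
  assumes p: "\<And>t. N \<le> t \<Longrightarrow> 0 < p t" and M: "\<And>t. N \<le> t \<Longrightarrow> 0 < M t"
    and k: "0 < k1" "0 < k4"
    and c: "\<And>t. N < t \<Longrightarrow> \<bar>c (t - 1)\<bar> \<le> k1 * M t"
    and dM: "\<And>t. N < t \<Longrightarrow> sqrt (p (t - 1)) * \<bar>bwd_diff M t\<bar> / (sqrt (M t) * M (t - 1)) \<le> k4"
    and sum: "(\<lambda>t. \<rho> t / sqrt (max (M t) 1)) summable_on {N<..}"
  shows "(\<lambda>t. \<rho> t / sqrt (M t)) summable_on {N<..}"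
proof -
  have \<rho>: "0 \<le> \<rho> t" for t by (simp add: \<rho>_def)
  define A where "A = {t. N < t \<and> M t < 1}"
  define P where "P = {t \<in> A. 1 \<le> p (t - 1)}"
  define K where "K = (1 + k1\<^sup>2) powr (1 / 4)"
  have "0 < 1 + k1\<^sup>2" by (rule add_pos_nonneg) auto
  hence K: "0 < K" by (simp add: K_def)
  have sA: "\<rho> summable_on A"
  proof -
    have "(\<lambda>t. \<rho> t / sqrt (max (M t) 1)) summable_on A"
      by (rule summable_on_subset[OF sum]) (auto simp: A_def)
    thus ?thesis by (rule summable_on_cong[THEN iffD1, rotated]) (auto simp: A_def max_def)
  qed
  have c1: "(c (t - 1))\<^sup>2 \<le> k1\<^sup>2" if "t \<in> A" for t
  proof -
    have "\<bar>c (t - 1)\<bar> \<le> k1 * M t" using c[of t] that by (simp add: A_def)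
    also have "\<dots> \<le> k1 * 1" using that k by (intro mult_left_mono) (auto simp: A_def)
    finally have "\<bar>c (t - 1)\<bar> \<le> k1" by simp
    thus ?thesis using k by (simp add: abs_le_square_iff[symmetric])
  qed
  have "finite (A - P)"
  proof (rule finite_if_bounded_below_summable)
    show "\<rho> summable_on (A - P)" by (rule summable_on_subset[OF sA]) auto
    show "1 / K \<le> \<rho> t" if t: "t \<in> A - P" for t
    proof -
      have "0 < p (t - 1)" "p (t - 1) < 1" using t p[of "t - 1"] by (auto simp: A_def P_def)
      hence "(p (t - 1))\<^sup>2 \<le> 1" and pos: "0 < (p (t - 1))\<^sup>2"
        by (auto simp: power_le_one)
      hence "((p (t - 1))\<^sup>2 + (c (t - 1))\<^sup>2) powr (1 / 4) \<le> K"
        unfolding K_def using c1[of t] t by (intro powr_mono2) auto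
      moreover have "0 < ((p (t - 1))\<^sup>2 + (c (t - 1))\<^sup>2) powr (1 / 4)"
        using pos by (simp add: add_pos_nonneg less_imp_neq[symmetric])
      ultimately show ?thesis unfolding \<rho>_def by (intro frac_le) auto
    qed
    show "0 < 1 / K" using K by simp
  qed
  hence "(\<lambda>t. 1 / sqrt (p (t - 1))) summable_on (A - P)" by simp
  moreover have "(\<lambda>t. 1 / sqrt (p (t - 1))) summable_on P"
  proof (rule summable_on_comparison_test)
    show "(\<lambda>t. K * \<rho> t) summable_on P"
      by (intro summable_on_cmult_right summable_on_subset[OF sA]) (auto simp: P_def)
    show "1 / sqrt (p (t - 1)) \<le> K * \<rho> t" if t: "t \<in> P" for t
    proof -
      define b where "b = p (t - 1)"
      have b: "1 \<le> b" using t by (simp add: P_def b_def)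
      hence b2: "1 \<le> b\<^sup>2" by simp
      have "b\<^sup>2 + (c (t - 1))\<^sup>2 \<le> b\<^sup>2 + k1\<^sup>2 * b\<^sup>2"
        using c1[of t] t b2 mult_left_mono[OF b2, of "k1\<^sup>2"] by (auto simp: P_def)
      hence "(b\<^sup>2 + (c (t - 1))\<^sup>2) powr (1 / 4) \<le> (b\<^sup>2 * (1 + k1\<^sup>2)) powr (1 / 4)"
        by (intro powr_mono2) (auto simp: algebra_simps)
      also have "\<dots> = (b\<^sup>2) powr (1 / 4) * K" by (simp add: K_def powr_mult)
      also have "(b\<^sup>2) powr (1 / 4) = sqrt b"
        using b by (simp add: powr_half_sqrt powr_powr flip: powr_numeral)
      finally have "(b\<^sup>2 + (c (t - 1))\<^sup>2) powr (1 / 4) \<le> sqrt b * K" .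
      moreover have "0 < b\<^sup>2 + (c (t - 1))\<^sup>2"
        using b2 by (intro add_pos_nonneg) auto
      ultimately have "1 / (sqrt b * K) \<le> \<rho> t"
        unfolding \<rho>_def b_def[symmetric] by (intro frac_le) auto
      thus ?thesis using K b by (simp add: field_simps b_def)
    qed
    show "0 \<le> 1 / sqrt (p (t - 1))" if "t \<in> P" for t
      using that p[of "t - 1"] by (auto simp: P_def A_def)
  qed
  ultimately have sp: "(\<lambda>t. 1 / sqrt (p (t - 1))) summable_on A"
    using summable_on_union[of _ "A - P" P] by (auto simp: P_def Un_absorb2 subset_iff)
  define S where "S T = (\<Sum>t\<in>{t\<in>A. t \<le> T}. 1 / sqrt (p (t - 1)))" for T
  have fin: "finite {t\<in>A. t \<le> T}" for T
    by (rule finite_subset[of _ "{N..T}"]) (auto simp: A_def)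
  have "0 \<le> 1 / sqrt (p (t - 1))" if "t \<in> A" for t
    using p[of "t - 1"] that by (simp add: A_def)
  hence SB: "S T \<le> (\<Sum>\<^sub>\<infinity>t\<in>A. 1 / sqrt (p (t - 1)))" for T
    unfolding S_def by (intro sum_le_infsum_real[OF sp fin]) auto
  have f: "max (1 / sqrt (M T)) 1 \<le> max (1 / sqrt (M N)) 1 + k4 * S T" if "N \<le> T" for T
    using that
  proof (induction T rule: int_ge_induct)
    case base
    have "S N = 0" by (auto simp: S_def A_def intro!: sum.neutral)
    thus ?case by simp
  next
    case (step T)
    show ?case
    proof (cases "T + 1 \<in> A")
      case True
      have "{t \<in> A. t \<le> T + 1} = insert (T + 1) {t \<in> A. t \<le> T}" using True by auto
      hence "S (T + 1) = 1 / sqrt (p T) + S T" using fin by (simp add: S_def)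
      moreover have "1 / sqrt (M (T + 1)) - 1 / sqrt (M T) \<le> k4 / sqrt (p T)"
        using step dM[of "T + 1"] p[of T] M[of T] M[of "T + 1"]
        by (intro inv_sqrt_lipschitz) (auto simp: bwd_diff_def)
      moreover have "0 \<le> k4 / sqrt (p T)" using k p[of T] step by simp
      ultimately show ?thesis using step(2) by (simp add: algebra_simps max_def split: if_splits)
    next
      case False
      hence "1 \<le> M (T + 1)" using step by (auto simp: A_def)
      moreover have "{t \<in> A. t \<le> T + 1} = {t \<in> A. t \<le> T}" using False by (auto simp: zle_add1_eq_le order_le_less)
      ultimately show ?thesis using step(2) by (simp add: S_def max_def split: if_splits)
    qed
  qed
  define B where "B = max (1 / sqrt (M N)) 1 + k4 * (\<Sum>\<^sub>\<infinity>t\<in>A. 1 / sqrt (p (t - 1)))"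
  have B: "max (1 / sqrt (M T)) 1 \<le> B" if "N \<le> T" for T
    unfolding B_def using k
    by (intro order_trans[OF f[OF that]] add_left_mono mult_left_mono SB) simp
  show ?thesis
  proof (rule summable_on_comparison_test)
    show "(\<lambda>t. B * (\<rho> t / sqrt (max (M t) 1))) summable_on {N<..}"
      by (rule summable_on_cmult_right[OF sum])
    show "\<rho> t / sqrt (M t) \<le> B * (\<rho> t / sqrt (max (M t) 1))" if t: "t \<in> {N<..}" for t
    proof -
      have "1 / sqrt (M t) \<le> B * (1 / sqrt (max (M t) 1))"
      proof (cases "M t < 1")
        case True
        thus ?thesis using B[of t] t by simp
      next
        case False
        thus ?thesis using B[of t] t mult_right_mono[of 1 B "1 / sqrt (M t)"] M[of t] by simp
      qed
      from mult_left_mono[OF this \<rho>[of t]] show ?thesis by (simp add: algebra_simps)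
    qed
    show "0 \<le> \<rho> t / sqrt (M t)" if "t \<in> {N<..}" for t
      using \<rho>[of t] M[of t] that by simp
  qed
qed

section \<open>Convergence of the weighted energy\<close>

text \<open>
  The primed letters are values at \<open>t - 1\<close>, the others at \<open>t\<close>. The increment of \<open>Re (cnj v V) / m\<close> is
  expanded by the product rule into the energy and five other terms. With \<open>x = v - v'\<close>, the critical one is
  \<open>(1 / m - 1 / m') P Re (x cnj v')\<close>. By the bound on \<open>m - m'\<close> its absolute value is at most
  \<open>k4 \<surd>(P / m) |x| |v'|\<close>, hence at most half of the energy plus a multiple of \<open>|v'|\<^sup>2\<close>. The other terms,
  the one with \<open>lam / m\<close> because of \<open>1 \<le> m\<close>, are bounded below by negative multiples of the squares.
\<close>

lemma energy_step:
  fixes v v' u u' V V' lam :: complex and P C q h m m' :: real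
  assumes V': "V' = of_real P * (v - v') + of_real C * u'"
    and dV: "V - V' = (of_real q - lam) * v + of_real h * u"
    and P: "0 < P" and m: "1 \<le> m" "1 \<le> m'" and k: "0 < k1" "0 < k2" "0 < k3"
    and C: "\<bar>C\<bar> \<le> k1 * m" "\<bar>C\<bar> \<le> k1 * m'" and h: "\<bar>h\<bar> \<le> k2 * m" and q: "- k3 * m \<le> q"
    and dm: "sqrt P * \<bar>m - m'\<bar> / (sqrt m * m') \<le> k4"
  shows "P * (cmod (v - v'))\<^sup>2 / m
    \<le> 2 * (Re (cnj v * V) / m - Re (cnj v' * V') / m')
      + 2 * (2 * k1 + k2 + k3 + k4\<^sup>2 + cmod lam)
        * ((cmod v)\<^sup>2 + (cmod v')\<^sup>2 + (cmod u)\<^sup>2 + (cmod u')\<^sup>2)"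
proof -
  define x g g' where "x = v - v'" and "g = 1 / m" and "g' = 1 / m'"
  have g: "0 < g" "g \<le> 1" "0 < g'" "g' \<le> 1" "g * m = 1" "g' * m' = 1"
    using m by (simp_all add: g_def g'_def)
  define S where "S = (cmod v)\<^sup>2 + (cmod v')\<^sup>2 + (cmod u)\<^sup>2 + (cmod u')\<^sup>2"
  have sq: "0 \<le> (cmod v)\<^sup>2" "0 \<le> (cmod v')\<^sup>2" "0 \<le> (cmod u)\<^sup>2" "0 \<le> (cmod u')\<^sup>2"
    by simp_all
  have prod: "2 * \<bar>Re (a * cnj b)\<bar> \<le> (cmod a)\<^sup>2 + (cmod b)\<^sup>2" for a b
    using abs_Re_le_cmod[of "a * cnj b"] two_mult_le_squares[of "cmod a" "cmod b"]
    by (simp add: norm_mult)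
  have "Re (cnj v * V) * g - Re (cnj v' * V') * g'
     = Re (V' * (cnj x * of_real g + cnj v' * of_real (g - g'))) + g * Re (cnj v * (V - V'))"
    by (simp add: x_def algebra_simps)
  also have "\<dots> = g * P * (cmod x)\<^sup>2 + g * C * Re (u' * cnj x) + (g - g') * P * Re (x * cnj v')
      + (g - g') * C * Re (u' * cnj v') + g * (q - Re lam) * (cmod v)\<^sup>2 + g * h * Re (u * cnj v)"
    unfolding dV unfolding V' x_def[symmetric] cmod_power2
    by (simp add: algebra_simps power2_eq_square)
  finally have G: "Re (cnj v * V) * g - Re (cnj v' * V') * g' = \<dots>" .
  have 1: "- (k1 * S) \<le> g * C * Re (u' * cnj x)"
  proof -
    have "\<bar>g * C\<bar> \<le> k1"
      using C(1) g m by (simp add: abs_mult g_def field_simps)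
    moreover have "\<bar>Re (u' * cnj x)\<bar> \<le> S"
    proof -
      have "Re (u' * cnj x) = Re (u' * cnj v) - Re (u' * cnj v')"
        by (simp add: x_def algebra_simps)
      hence "\<bar>Re (u' * cnj x)\<bar> \<le> \<bar>Re (u' * cnj v)\<bar> + \<bar>Re (u' * cnj v')\<bar>"
        by (metis abs_triangle_ineq4)
      thus ?thesis using prod[of u' v] prod[of u' v'] sq unfolding S_def by linarith
    qed
    ultimately have "\<bar>g * C\<bar> * \<bar>Re (u' * cnj x)\<bar> \<le> k1 * S"
      using k by (intro mult_mono) auto
    thus ?thesis by (simp add: abs_mult[symmetric] abs_le_iff)
  qed
  have 2: "- (g * P * (cmod x)\<^sup>2 / 2) - k4\<^sup>2 * S \<le> (g - g') * P * Re (x * cnj v')"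
  proof -
    define e where "e = sqrt (g * P)"
    have e: "e\<^sup>2 = g * P" "0 \<le> e" using g P by (simp_all add: e_def)
    have "\<bar>g - g'\<bar> * P = sqrt g * sqrt P * (sqrt P * \<bar>m - m'\<bar> / (sqrt m * m'))"
    proof -
      have "\<bar>g - g'\<bar> = \<bar>m - m'\<bar> / (m * m')"
        using m by (simp add: g_def g'_def field_simps abs_minus_commute flip: abs_mult)
      moreover have "sqrt g * (1 / sqrt m) = 1 / m"
        using m by (simp add: g_def real_sqrt_divide)
      moreover have "sqrt P * sqrt P = P" using P by simp
      moreover have "a / (m * m') * (s * s) = r * s * (s * a / (w * m'))"
        if "r * (1 / w) = 1 / m" for a s r w :: real
        using that by (metis (no_types, opaque_lifting) divide_divide_eq_left mult.assoc mult.commute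
            times_divide_eq_left times_divide_eq_right mult_1)
      ultimately show ?thesis by metis
    qed
    also have "\<dots> \<le> sqrt g * sqrt P * k4"
      using g P by (intro mult_left_mono dm) auto
    finally have le: "\<bar>g - g'\<bar> * P \<le> e * k4" by (simp add: e_def real_sqrt_mult)
    have "0 \<le> \<bar>g - g'\<bar> * P" using P by simp
    hence "0 \<le> e * k4" using le by (rule order_trans)
    moreover have "\<bar>Re (x * cnj v')\<bar> \<le> cmod x * cmod v'"
      using abs_Re_le_cmod[of "x * cnj v'"] by (simp add: norm_mult)
    ultimately have "\<bar>g - g'\<bar> * P * \<bar>Re (x * cnj v')\<bar> \<le> e * k4 * (cmod x * cmod v')"
      using mult_mono[OF le] abs_ge_zero by blast
    also have "\<dots> \<le> (e\<^sup>2 * (cmod x)\<^sup>2 + k4\<^sup>2 * (cmod v')\<^sup>2) / 2"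
      using two_mult_le_squares[of "e * cmod x" "k4 * cmod v'"]
      by (simp add: power_mult_distrib algebra_simps)
    also have "\<dots> \<le> g * P * (cmod x)\<^sup>2 / 2 + k4\<^sup>2 * S"
    proof -
      have "k4\<^sup>2 * (cmod v')\<^sup>2 \<le> k4\<^sup>2 * S" by (intro mult_left_mono) (auto simp: S_def)
      moreover have "0 \<le> k4\<^sup>2 * S" by (simp add: S_def)
      ultimately show ?thesis by (simp add: e field_simps)
    qed
    finally have "\<bar>g - g'\<bar> * P * \<bar>Re (x * cnj v')\<bar> \<le> g * P * (cmod x)\<^sup>2 / 2 + k4\<^sup>2 * S" .
    moreover have "\<bar>(g - g') * P * Re (x * cnj v')\<bar> = \<bar>g - g'\<bar> * P * \<bar>Re (x * cnj v')\<bar>"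
      by (simp only: abs_mult abs_of_pos[OF P])
    ultimately show ?thesis by linarith
  qed
  have 3: "- (k1 * S) \<le> (g - g') * C * Re (u' * cnj v')"
  proof -
    have "\<bar>g * C\<bar> \<le> k1" "\<bar>g' * C\<bar> \<le> k1"
      using C g m by (simp_all add: abs_mult g_def g'_def field_simps)
    hence "\<bar>(g - g') * C\<bar> \<le> 2 * k1" by (simp add: left_diff_distrib)
    moreover have "2 * \<bar>Re (u' * cnj v')\<bar> \<le> S"
      using prod[of u' v'] sq unfolding S_def by linarith
    ultimately have "\<bar>(g - g') * C\<bar> * (2 * \<bar>Re (u' * cnj v')\<bar>) \<le> 2 * k1 * S"
      using k by (intro mult_mono) auto
    hence "\<bar>(g - g') * C * Re (u' * cnj v')\<bar> \<le> k1 * S" unfolding abs_mult by simp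
    thus ?thesis by linarith
  qed
  have 4: "- ((k3 + cmod lam) * S) \<le> g * (q - Re lam) * (cmod v)\<^sup>2"
  proof -
    have "g * (- k3 * m) = - k3 * (g * m)" by simp
    also have "\<dots> = - k3" using g by simp
    finally have "- k3 \<le> g * q"
      using mult_left_mono[OF q, of g] g(1) by linarith
    moreover have "g * Re lam \<le> cmod lam"
    proof -
      have "g * Re lam \<le> g * cmod lam"
        using g by (intro mult_left_mono complex_Re_le_cmod) auto
      also have "\<dots> \<le> 1 * cmod lam" using g by (intro mult_right_mono) auto
      finally show ?thesis by simp
    qed
    ultimately have "- (k3 + cmod lam) * (cmod v)\<^sup>2 \<le> g * (q - Re lam) * (cmod v)\<^sup>2"
      by (intro mult_right_mono) (auto simp: right_diff_distrib)
    moreover have "(k3 + cmod lam) * (cmod v)\<^sup>2 \<le> (k3 + cmod lam) * S"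
      using k by (intro mult_left_mono) (auto simp: S_def)
    ultimately show ?thesis unfolding mult_minus_left by linarith
  qed
  have 5: "- (k2 * S) \<le> g * h * Re (u * cnj v)"
  proof -
    have "\<bar>g * h\<bar> \<le> k2" using h g m by (simp add: abs_mult g_def field_simps)
    moreover have "\<bar>Re (u * cnj v)\<bar> \<le> S"
      using prod[of u v] sq unfolding S_def by linarith
    ultimately have "\<bar>g * h\<bar> * \<bar>Re (u * cnj v)\<bar> \<le> k2 * S"
      using k by (intro mult_mono) auto
    thus ?thesis by (simp add: abs_mult[symmetric] abs_le_iff)
  qed
  have "g * P * (cmod x)\<^sup>2 \<le> 2 * (Re (cnj v * V) * g - Re (cnj v' * V') * g')
     + 2 * (2 * k1 + k2 + k3 + k4\<^sup>2 + cmod lam) * S"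
    using 1 2 3 4 5 unfolding G by (simp add: algebra_simps)
  thus ?thesis by (simp add: g_def g'_def x_def S_def mult.commute)
qed

lemma weighted_energy_summable:
  fixes v u V :: "int \<Rightarrow> complex" and lam :: complex and p q c h M :: "int \<Rightarrow> real"
  assumes V: "\<And>t. N \<le> t \<Longrightarrow> V t = of_real (p t) * (v (t + 1) - v t) + of_real (c t) * u t"
    and dV: "\<And>t. N < t \<Longrightarrow> V t - V (t - 1) = (of_real (q t) - lam) * v t + of_real (h t) * u t"
    and p: "\<And>t. N \<le> t \<Longrightarrow> 0 < p t" and M: "\<And>t. N \<le> t \<Longrightarrow> 1 \<le> M t"
    and k: "0 < k1" "0 < k2" "0 < k3"
    and c: "\<And>t. N < t \<Longrightarrow> \<bar>c t\<bar> \<le> k1 * M t" "\<And>t. N < t \<Longrightarrow> \<bar>c (t - 1)\<bar> \<le> k1 * M t"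
    and h: "\<And>t. N < t \<Longrightarrow> \<bar>h t\<bar> \<le> k2 * M t"
    and q: "\<And>t. N < t \<Longrightarrow> - k3 * M t \<le> q t"
    and dM: "\<And>t. N < t \<Longrightarrow> sqrt (p (t - 1)) * \<bar>M t - M (t - 1)\<bar> / (sqrt (M t) * M (t - 1)) \<le> k4"
    and l2: "(\<lambda>t. (cmod (v t))\<^sup>2 + (cmod (u t))\<^sup>2) summable_on {N..}"
  shows "(\<lambda>t. p (t - 1) * (cmod (v t - v (t - 1)))\<^sup>2 / M t) summable_on {N<..}"
proof -
  define E where "E t = p (t - 1) * (cmod (v t - v (t - 1)))\<^sup>2 / M t" for t
  define R where "R t = (cmod (v t))\<^sup>2 + (cmod (u t))\<^sup>2" for t
  define G where "G t = Re (cnj (v t) * V t) / M t" for t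
  define K where "K = 2 * (2 * k1 + k2 + k3 + k4\<^sup>2 + cmod lam)"
  have K: "0 \<le> K" using k by (simp add: K_def)
  have R: "R summable_on {N..}" using l2 by (simp add: R_def[abs_def])
  have R0: "0 \<le> R t" for t by (simp add: R_def)
  define r where "r = infsum R {N..}"
  have Rsum: "sum R B \<le> r" if "finite B" "B \<subseteq> {N..}" for B
    unfolding r_def using that by (intro sum_le_infsum_real[OF R] R0) auto
  have E0: "0 \<le> E t" if "N < t" for t
    using p[of "t - 1"] M[of t] that by (simp add: E_def)
  \<comment> \<open>The range starts at \<open>N + 2\<close> because the bound of \<open>c (t - 1)\<close> by \<open>k1 * M (t - 1)\<close> is available
    only for \<open>N < t - 1\<close>.\<close>
  have step_bound: "E t \<le> 2 * (G t - G (t - 1)) + K * (R t + R (t - 1))" if t: "N + 1 < t" for t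
  proof -
    have "E t \<le> 2 * (G t - G (t - 1)) + K
        * ((cmod (v t))\<^sup>2 + (cmod (v (t - 1)))\<^sup>2 + (cmod (u t))\<^sup>2 + (cmod (u (t - 1)))\<^sup>2)"
      unfolding E_def G_def K_def
    proof (rule energy_step)
      show "V (t - 1) = of_real (p (t - 1)) * (v t - v (t - 1)) + of_real (c (t - 1)) * u (t - 1)"
        using V[of "t - 1"] t by simp
      show "V t - V (t - 1) = (of_real (q t) - lam) * v t + of_real (h t) * u t"
        using dV t by simp
      show "\<bar>c (t - 1)\<bar> \<le> k1 * M t" "\<bar>c (t - 1)\<bar> \<le> k1 * M (t - 1)"
        using c(1)[of "t - 1"] c(2)[of t] t by auto
    qed (use t p M k h q dM in auto)
    thus ?thesis by (simp add: R_def add_ac)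
  qed
  have sumE: "(\<Sum>t\<in>{N + 1<..T}. E t)
      \<le> 2 * (G T - G (N + 1)) + K * (\<Sum>t\<in>{N + 1<..T}. R t + R (t - 1))" if "N + 1 \<le> T" for T
    using that
  proof (induction T rule: int_ge_induct)
    case base
    show ?case by simp
  next
    case (step T)
    have "{N + 1<..T + 1} = insert (T + 1) {N + 1<..T}" using step(1) by auto
    thus ?case using step(2) step(1) step_bound[of "T + 1"]
      by (simp add: algebra_simps)
  qed
  have sumR: "(\<Sum>t\<in>{N + 1<..T}. R t + R (t - 1)) \<le> 2 * r" for T
  proof -
    have "(\<Sum>t\<in>{N + 1<..T}. R (t - 1)) = sum R ((\<lambda>t. t - 1) ` {N + 1<..T})"
      by (subst sum.reindex) (auto simp: inj_on_def)
    also have "\<dots> \<le> r" by (intro Rsum) auto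
    finally show ?thesis using Rsum[of "{N + 1<..T}"] by (simp add: sum.distrib subset_iff)
  qed
  define L where "L = k1 * r"
  \<comment> \<open>\<open>L\<close> bounds the part of \<open>G\<close> that comes from \<open>c\<close>. Above it, the part
    \<open>p Re (cnj (v T) (v (T + 1) - v T)) / M\<close> is positive.\<close>
  have G: "cmod (v T) < cmod (v (T + 1))" if T: "N < T" and GT: "L < G T" for T
  proof -
    have m: "0 < M T" using M[of T] T by simp
    have "\<bar>Re (cnj (v T) * u T)\<bar> \<le> R T"
      using abs_Re_le_cmod[of "cnj (v T) * u T"] two_mult_le_squares[of "cmod (v T)" "cmod (u T)"]
        mult_nonneg_nonneg[of "cmod (v T)" "cmod (u T)"]
      by (simp add: norm_mult R_def)
    also have "R T \<le> r" using Rsum[of "{T}"] T by simp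
    finally have "\<bar>c T\<bar> * \<bar>Re (cnj (v T) * u T)\<bar> \<le> k1 * M T * r"
      using c(1)[OF T] by (intro mult_mono) auto
    hence "c T * Re (cnj (v T) * u T) \<le> L * M T"
      unfolding L_def abs_mult[symmetric] by (simp add: abs_le_iff algebra_simps)
    moreover have "L * M T < Re (cnj (v T) * V T)"
      using GT m by (simp add: G_def field_simps)
    moreover have "Re (cnj (v T) * V T)
        = p T * Re (cnj (v T) * (v (T + 1) - v T)) + c T * Re (cnj (v T) * u T)"
    proof -
      have "V T = of_real (p T) * (v (T + 1) - v T) + of_real (c T) * u T" using V T by simp
      thus ?thesis by (simp only:) (simp add: algebra_simps)
    qed
    ultimately have "0 < p T * Re (cnj (v T) * (v (T + 1) - v T))" by linarith
    hence pos: "0 < Re (cnj (v T) * (v (T + 1) - v T))"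
      using p[of T] T by (simp add: zero_less_mult_iff)
    have "Re (cnj (v T) * (v (T + 1) - v T)) = Re (cnj (v T) * v (T + 1)) - (cmod (v T))\<^sup>2"
      unfolding cmod_power2 by (simp add: algebra_simps power2_eq_square)
    hence "(cmod (v T))\<^sup>2 < cmod (v T) * cmod (v (T + 1))"
      using pos complex_Re_le_cmod[of "cnj (v T) * v (T + 1)"] by (simp add: norm_mult)
    thus ?thesis by (simp add: power2_eq_square mult_less_cancel_left_disj)
  qed
  have v2: "(\<lambda>t. (cmod (v t))\<^sup>2) summable_on {N..}"
    by (rule summable_on_comparison_test[OF l2]) auto
  \<comment> \<open>The partial sums are compared at a later time \<open>T'\<close> at which \<open>|v|\<close> does not increase, so that
    \<open>G T' \<le> L\<close>.\<close>
  have bound: "sum E {N + 1<..T} \<le> 2 * (L - G (N + 1)) + K * (2 * r)" if T: "N + 1 < T" for T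
  proof -
    obtain T' where T': "T \<le> T'" "cmod (v (T' + 1)) \<le> cmod (v T')"
      using square_summable_has_late_nonincrease[OF v2, of T] T by auto
    hence "G T' \<le> L" using G[of T'] T by force
    moreover have "sum E {N + 1<..T} \<le> sum E {N + 1<..T'}"
      using T' by (intro sum_mono2) (auto intro: E0)
    moreover have "K * (\<Sum>t\<in>{N + 1<..T'}. R t + R (t - 1)) \<le> K * (2 * r)"
      by (intro mult_left_mono sumR K)
    ultimately show ?thesis using sumE[of T'] T T' by simp
  qed
  have "E summable_on {N + 1<..}"
    by (rule nonneg_summable_on_greaterThanI[OF _ bound]) (auto intro: E0)
  moreover have "{N<..} = insert (N + 1) {N + 1<..}" by auto
  ultimately have "E summable_on {N<..}" by (simp add: summable_on_insert_iff)
  thus ?thesis by (simp add: E_def[abs_def])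
qed

text \<open>
  With \<open>s = \<surd>(P\<^sup>2 + C\<^sup>2)\<close> the squared weight is \<open>1 / (s m)\<close>. In \<open>|V|\<^sup>2 \<le> 2 P\<^sup>2 |x|\<^sup>2 + 2 C\<^sup>2 |y|\<^sup>2\<close> one factor \<open>P\<close>
  and one factor \<open>|C|\<close> are at most \<open>s\<close>, and the other \<open>|C|\<close> is at most \<open>k1 m\<close>.
\<close>

lemma quasi_derivative_weight_summable:
  fixes v u V :: "int \<Rightarrow> complex" and p c M :: "int \<Rightarrow> real"
  assumes V: "\<And>t. N \<le> t \<Longrightarrow> V t = of_real (p t) * (v (t + 1) - v t) + of_real (c t) * u t"
    and p: "\<And>t. N \<le> t \<Longrightarrow> 0 < p t" and M: "\<And>t. N \<le> t \<Longrightarrow> 0 < M t"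
    and c: "\<And>t. N < t \<Longrightarrow> \<bar>c (t - 1)\<bar> \<le> k1 * M t"
    and energy: "(\<lambda>t. p (t - 1) * (cmod (v t - v (t - 1)))\<^sup>2 / M t) summable_on {N<..}"
    and l2: "(\<lambda>t. (cmod (u t))\<^sup>2) summable_on {N..}"
  shows "(\<lambda>t. (1 / (((p (t - 1))\<^sup>2 + (c (t - 1))\<^sup>2) powr (1 / 4)) / sqrt (M t))\<^sup>2
            * (cmod (V (t - 1)))\<^sup>2) summable_on {N<..}"
proof (rule summable_on_comparison_test)
  show "(\<lambda>t. 2 * (p (t - 1) * (cmod (v t - v (t - 1)))\<^sup>2 / M t) + 2 * k1 * (cmod (u (t - 1)))\<^sup>2)
      summable_on {N<..}"
    by (intro summable_on_add summable_on_cmult_right energy summable_on_shift l2)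
  fix t assume "t \<in> {N<..}"
  hence t: "N < t" by simp
  define P C m where "P = p (t - 1)" and "C = c (t - 1)" and "m = M t"
  define x y where "x = v t - v (t - 1)" and "y = u (t - 1)"
  have P: "0 < P" and m: "0 < m" and C: "\<bar>C\<bar> \<le> k1 * m"
    using p[of "t - 1"] M[of t] c[of t] t by (auto simp: P_def m_def C_def)
  have VV: "V (t - 1) = of_real P * x + of_real C * y"
    using V[of "t - 1"] t by (simp add: P_def C_def x_def y_def)
  define s where "s = sqrt (P\<^sup>2 + C\<^sup>2)"
  have s: "P \<le> s" "\<bar>C\<bar> \<le> s"
    using P by (simp_all add: s_def real_le_rsqrt)
  have s0: "0 < s" using s(1) P by linarith
  have w: "(1 / ((P\<^sup>2 + C\<^sup>2) powr (1 / 4)) / sqrt m)\<^sup>2 = 1 / (s * m)"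
  proof -
    have "((P\<^sup>2 + C\<^sup>2) powr (1 / 4))\<^sup>2 = s"
      by (simp add: s_def power2_eq_square powr_half_sqrt flip: powr_add)
    thus ?thesis using m by (simp add: power_divide power_mult_distrib)
  qed
  have "(cmod (V (t - 1)))\<^sup>2 \<le> (P * cmod x + \<bar>C\<bar> * cmod y)\<^sup>2"
    unfolding VV using P norm_triangle_ineq[of "of_real P * x" "of_real C * y"]
    by (intro power_mono) (simp_all add: norm_mult)
  also have "\<dots> \<le> 2 * (P\<^sup>2 * (cmod x)\<^sup>2) + 2 * (C\<^sup>2 * (cmod y)\<^sup>2)"
    using two_mult_le_squares[of "P * cmod x" "\<bar>C\<bar> * cmod y"]
    by (simp add: power2_sum power_mult_distrib)
  also have "\<dots> \<le> 2 * (P * s * (cmod x)\<^sup>2) + 2 * (k1 * m * s * (cmod y)\<^sup>2)"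
  proof -
    have "P\<^sup>2 \<le> P * s" using P s by (simp add: power2_eq_square)
    moreover have "C\<^sup>2 \<le> k1 * m * s"
      using mult_mono[OF C s(2)] C by (simp add: power2_eq_square flip: abs_mult)
    ultimately show ?thesis by (intro add_mono mult_left_mono mult_right_mono) auto
  qed
  also have "\<dots> = (s * m) * (2 * (P * (cmod x)\<^sup>2 / m) + 2 * k1 * (cmod y)\<^sup>2)"
    using m by (simp add: field_simps)
  finally show "(1 / (((p (t - 1))\<^sup>2 + (c (t - 1))\<^sup>2) powr (1 / 4)) / sqrt (M t))\<^sup>2
            * (cmod (V (t - 1)))\<^sup>2
      \<le> 2 * (p (t - 1) * (cmod (v t - v (t - 1)))\<^sup>2 / M t) + 2 * k1 * (cmod (u (t - 1)))\<^sup>2"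
    using s0 m w
    by (simp add: P_def[symmetric] C_def[symmetric] m_def[symmetric] x_def[symmetric]
        y_def[symmetric] pos_divide_le_eq mult.commute)
qed auto

section \<open>The limit point criterion\<close>

text \<open>
  The Wronskian is \<open>1\<close>, so \<open>w\<close> is at most \<open>|y\<^sub>1| w |z\<^sup>[\<^sup>1\<^sup>]| + |z\<^sub>1| w |y\<^sup>[\<^sup>1\<^sup>]|\<close>, and each product is at most the
  sum of two summable squares.
\<close>

lemma weight_summable_if_all_solutions_square_summable:
  fixes p c w :: "int \<Rightarrow> real"
  assumes y: "solves_system a p q c h d lam y" and z: "solves_system a p q c h d lam z"
    and N: "a \<le> N"
    and wronskian: "y a $ 1 * quasi_diff p c z (a - 1) - quasi_diff p c y (a - 1) * z a $ 1 = 1"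
    and y2: "(\<lambda>t. (cmod (y t $ 1))\<^sup>2) summable_on {N..}"
    and z2: "(\<lambda>t. (cmod (z t $ 1))\<^sup>2) summable_on {N..}"
    and wy: "(\<lambda>t. (w t)\<^sup>2 * (cmod (quasi_diff p c y (t - 1)))\<^sup>2) summable_on {N<..}"
    and wz: "(\<lambda>t. (w t)\<^sup>2 * (cmod (quasi_diff p c z (t - 1)))\<^sup>2) summable_on {N<..}"
    and w: "\<And>t. 0 \<le> w t"
  shows "w summable_on {N<..}"
proof (rule summable_on_comparison_test)
  let ?Y = "quasi_diff p c y" and ?Z = "quasi_diff p c z"
  show "(\<lambda>t. ((cmod (y t $ 1))\<^sup>2 + (w t)\<^sup>2 * (cmod (?Z (t - 1)))\<^sup>2)
      + ((cmod (z t $ 1))\<^sup>2 + (w t)\<^sup>2 * (cmod (?Y (t - 1)))\<^sup>2)) summable_on {N<..}"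
    by (intro summable_on_add wy wz summable_on_subset[OF y2] summable_on_subset[OF z2]) auto
  show "w t \<le> ((cmod (y t $ 1))\<^sup>2 + (w t)\<^sup>2 * (cmod (?Z (t - 1)))\<^sup>2)
      + ((cmod (z t $ 1))\<^sup>2 + (w t)\<^sup>2 * (cmod (?Y (t - 1)))\<^sup>2)" if "t \<in> {N<..}" for t
  proof -
    have "y t $ 1 * ?Z (t - 1) - ?Y (t - 1) * z t $ 1 = 1"
      using wronskian_constant[OF y z, of t] N that wronskian by simp
    hence "1 \<le> cmod (y t $ 1 * ?Z (t - 1)) + cmod (?Y (t - 1) * z t $ 1)"
      by (metis norm_triangle_ineq4 norm_one)
    from mult_left_mono[OF this w[of t]]
    have "w t \<le> cmod (y t $ 1) * (w t * cmod (?Z (t - 1))) + cmod (z t $ 1) * (w t * cmod (?Y (t - 1)))"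
      by (simp add: norm_mult algebra_simps)
    moreover have "r * (w t * s) \<le> r\<^sup>2 + (w t)\<^sup>2 * s\<^sup>2" if "0 \<le> r" "0 \<le> s" for r s
      using two_mult_le_squares[of r "w t * s"] mult_nonneg_nonneg[OF that(1) mult_nonneg_nonneg[OF w[of t] that(2)]]
      unfolding power_mult_distrib by linarith
    ultimately show ?thesis by (meson add_mono norm_ge_zero order_trans)
  qed
qed (use w in auto)

theorem theorem5p2:
  fixes a N :: int
    and p q c h d M :: "int \<Rightarrow> real"
    and k1 k2 k3 k4 :: real
  assumes p_nonzero: "\<forall>t\<ge>a - 1. p t \<noteq> 0"
    and p_pos: "\<forall>t\<ge>a. p t > 0"
    and N: "N \<ge> a"
    and M_pos: "\<forall>t\<ge>N. M t > 0"
    and k_pos: "k1 > 0" "k2 > 0" "k3 > 0" "k4 > 0"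
    and cond1: "\<forall>t>N. \<bar>c t\<bar> + \<bar>c (t - 1)\<bar> \<le> k1 * M t \<and> \<bar>h t\<bar> \<le> k2 * M t"
    and cond2: "\<forall>t>N. q t \<ge> - k3 * M t"
    and cond3: "\<forall>t>N. sqrt (p (t - 1)) * \<bar>bwd_diff M t\<bar> / (sqrt (M t) * M (t - 1)) \<le> k4"
    and cond4: "filterlim
      (\<lambda>T. \<Sum>t = N..T. 1 / (((p (t - 1))\<^sup>2 + (c (t - 1))\<^sup>2) powr (1 / 4) * sqrt (M t)))
      at_top at_top"
  shows "limit_point_case a p q c h d"
  unfolding limit_point_case_def
proof (intro allI impI)
  fix lam :: complex and \<alpha> :: real and \<phi> \<psi>
  assume lam: "lam \<notin> \<real>"
    and "solves_ivp a p q c h d lam (of_real (sin \<alpha>)) (- of_real (cos \<alpha>)) \<phi>"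
    and "solves_ivp a p q c h d lam (of_real (cos \<alpha>)) (of_real (sin \<alpha>)) \<psi>"
  hence \<phi>: "solves_system a p q c h d lam \<phi>" and \<psi>: "solves_system a p q c h d lam \<psi>"
    and init: "\<phi> a $ 1 = of_real (sin \<alpha>)" "quasi_diff p c \<phi> (a - 1) = - of_real (cos \<alpha>)"
      "\<psi> a $ 1 = of_real (cos \<alpha>)" "quasi_diff p c \<psi> (a - 1) = of_real (sin \<alpha>)"
    by (simp_all add: solves_ivp_def)
  have wronskian: "\<phi> a $ 1 * quasi_diff p c \<psi> (a - 1) - quasi_diff p c \<phi> (a - 1) * \<psi> a $ 1 = 1"
    using arg_cong[OF sin_cos_squared_add[of \<alpha>], of complex_of_real]
    by (simp add: init power2_eq_square)
  have real: "Im (cnj (\<psi> a $ 1) * quasi_diff p c \<psi> (a - 1)) = 0"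
    by (simp add: init)
  have M: "0 < M t" if "N \<le> t" for t using M_pos that by simp
  have c: "\<bar>c t\<bar> \<le> k1 * M t" "\<bar>c (t - 1)\<bar> \<le> k1 * M t" if "N < t" for t
    using cond1 that abs_ge_zero[of "c t"] abs_ge_zero[of "c (t - 1)"]
    by (smt (verit))+
  define m where "m t = max (M t) 1" for t
  have m: "1 \<le> m t" "M t \<le> m t" for t by (simp_all add: m_def)
  have le_m: "k * M t \<le> k * m t" if "0 < k" for k t
    using that m(2) by (intro mult_left_mono) auto
  have dm: "sqrt (p (t - 1)) * \<bar>m t - m (t - 1)\<bar> / (sqrt (m t) * m (t - 1)) \<le> k4" if t: "N < t" for t
  proof -
    have "0 < p (t - 1)" using p_pos N t by simp
    moreover have "\<bar>m t - m (t - 1)\<bar> \<le> \<bar>bwd_diff M t\<bar>" by (simp add: m_def bwd_diff_def)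
    ultimately have "sqrt (p (t - 1)) * \<bar>m t - m (t - 1)\<bar> / (sqrt (m t) * m (t - 1))
        \<le> sqrt (p (t - 1)) * \<bar>bwd_diff M t\<bar> / (sqrt (M t) * M (t - 1))"
      using M[of t] M[of "t - 1"] t m(2)[of t] m(2)[of "t - 1"]
      by (intro frac_le mult_left_mono mult_mono) auto
    thus ?thesis using cond3 t by force
  qed
  define w where "w t = 1 / (((p (t - 1))\<^sup>2 + (c (t - 1))\<^sup>2) powr (1 / 4)) / sqrt (m t)" for t
  have weight: "(\<lambda>t. (w t)\<^sup>2 * (cmod (quasi_diff p c y (t - 1)))\<^sup>2) summable_on {N<..}"
    and first: "(\<lambda>t. (cmod (y t $ 1))\<^sup>2) summable_on {N..}"
    if y: "solves_system a p q c h d lam y" and l2: "square_summable a y" for y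
  proof -
    have l2N: "(\<lambda>t. (cmod (y t $ 1))\<^sup>2 + (cmod (y t $ 2))\<^sup>2) summable_on {N..}"
      by (rule summable_on_subset[OF l2[unfolded square_summable_def]]) (use N in auto)
    show "(\<lambda>t. (cmod (y t $ 1))\<^sup>2) summable_on {N..}"
      by (rule summable_on_comparison_test[OF l2N]) auto
    have V: "quasi_diff p c y t = of_real (p t) * (y (t + 1) $ 1 - y t $ 1) + of_real (c t) * y t $ 2" for t
      by (simp add: quasi_diff_def fwd_diff_def)
    have "(\<lambda>t. p (t - 1) * (cmod (y t $ 1 - y (t - 1) $ 1))\<^sup>2 / m t) summable_on {N<..}"
    proof (rule weighted_energy_summable[where V = "quasi_diff p c y" and c = c and u = "\<lambda>t. y t $ 2"
          and lam = lam and q = q and h = h])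
      show "quasi_diff p c y t - quasi_diff p c y (t - 1)
          = (of_real (q t) - lam) * y t $ 1 + of_real (h t) * y t $ 2" if "N < t" for t
        using y that N unfolding solves_system_iff by (auto simp: algebra_simps)
      show "\<bar>c t\<bar> \<le> k1 * m t" "\<bar>c (t - 1)\<bar> \<le> k1 * m t" if "N < t" for t
        using c[OF that] le_m[OF k_pos(1), of t] by linarith+
      show "\<bar>h t\<bar> \<le> k2 * m t" if "N < t" for t
        using cond1 that le_m[OF k_pos(2), of t] by force
      show "- k3 * m t \<le> q t" if "N < t" for t
        using cond2 that le_m[OF k_pos(3), of t] by force
    qed (use V p_pos N m k_pos dm l2N in auto)
    thus "(\<lambda>t. (w t)\<^sup>2 * (cmod (quasi_diff p c y (t - 1)))\<^sup>2) summable_on {N<..}"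
      unfolding w_def
    proof (rule quasi_derivative_weight_summable[where u = "\<lambda>t. y t $ 2" and ?k1.0 = k1, rotated 4])
      show "(\<lambda>t. (cmod (y t $ 2))\<^sup>2) summable_on {N..}"
        by (rule summable_on_comparison_test[OF l2N]) auto
      show "\<bar>c (t - 1)\<bar> \<le> k1 * m t" if "N < t" for t
        using c(2)[OF that] le_m[OF k_pos(1), of t] by linarith
      show "0 < m t" for t using m(1)[of t] by linarith
    qed (use V p_pos N in auto)
  qed
  have "\<not> (square_summable a \<phi> \<and> square_summable a \<psi>)"
  proof
    assume l2: "square_summable a \<phi> \<and> square_summable a \<psi>"
    have w: "w summable_on {N<..}"
      by (rule weight_summable_if_all_solutions_square_summable[OF \<phi> \<psi> N wronskian])
        (use weight[OF \<phi>] weight[OF \<psi>] first[OF \<phi>] first[OF \<psi>] l2 m(1) in \<open>auto simp: w_def m_def\<close>)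
    define W where "W t = 1 / ((p (t - 1))\<^sup>2 + (c (t - 1))\<^sup>2) powr (1 / 4) / sqrt (M t)" for t
    have "W summable_on {N<..}"
      unfolding W_def
      by (rule weight_summable_if_max_weight_summable[where N = N and ?k1.0 = k1 and ?k4.0 = k4])
        (use p_pos N M c k_pos cond3 w in \<open>auto simp: w_def[abs_def] m_def\<close>)
    moreover have W0: "0 \<le> W t" if "N \<le> t" for t using M[OF that] by (simp add: W_def)
    ultimately have "sum W {N..T} \<le> W N + infsum W {N<..}" for T
    proof -
      have "sum W {N..T} \<le> sum W (insert N {N<..T})"
        using W0 by (intro sum_mono2) auto
      also have "\<dots> = W N + sum W {N<..T}" by simp
      also have "sum W {N<..T} \<le> infsum W {N<..}"
        using W0 \<open>W summable_on {N<..}\<close> by (intro sum_le_infsum_real) auto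
      finally show ?thesis by simp
    qed
    moreover have "filterlim (\<lambda>T. sum W {N..T}) at_top at_top"
      using cond4 by (simp add: W_def[abs_def])
    hence "eventually (\<lambda>T. W N + infsum W {N<..} < sum W {N..T}) at_top"
      by (simp add: filterlim_at_top_dense)
    ultimately have "eventually (\<lambda>T::int. False) at_top"
      by (metis (mono_tags, lifting) eventually_mono not_le)
    thus False by simp
  qed
  thus "circles_converge_to_point a (weyl_circle p c \<phi> \<psi>)"
    by (rule circles_converge_if_not_all_square_summable[OF lam \<phi> \<psi> wronskian real])
qed

end
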